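(* Let $X$ be a metrizable (real) locally convex space not containing any $\ell_1$-sequence. Then $X$ has the weak-AFPP.
   Context: Vector spaces are real. A nonempty bounded closed convex subset $C$ of a Hausdorff topological vector space $X$ (with topological dual $X^*$) has the weak-AFPP (weak approximate fixed point property) if for every continuous mapping $f\colon C\to C$ (continuous for the original topology of $X$) there is a sequence $(x_n)$ in $C$ such that $x^*(x_n-f(x_n))\to 0$ for all $x^*\in X^*$. The space $X$ has the weak-AFPP if every nonempty bounded closed convex subset of $X$ has it. Let $\ell_1^0$ be the subspace of $\ell_1$ formed by elements with only finitely many nonzero coordinates, equipped with the $\ell_1$-norm. A sequence $(x_n)$ in a topological vector space $X$ is an $\ell_1$-sequence if the linear mapping $T_0\colon\ell_1^0\to X$, $T_0((a_i)_{i=1}^\infty)=\sum_{i=1}^\infty a_ix_i$, is an isomorphism (linear homeomorphism) of $\ell_1^0$ onto $T_0(\ell_1^0)$. *)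

theory Defs
  imports "HOL-Analysis.Analysis" "HOL-Analysis.Finite_Function_Topology"
begin

class topological_real_vector = real_vector + topological_ab_group_add +
  assumes tendsto_scaleR_Pair:
    "LIM p (nhds a \<times>\<^sub>F nhds b). fst p *\<^sub>R snd p :> nhds (a *\<^sub>R b)"

instance real_normed_vector < topological_real_vector
proof
  fix a :: real and b :: 'a
  show "LIM p (nhds a \<times>\<^sub>F nhds b). fst p *\<^sub>R snd p :> nhds (a *\<^sub>R b)"
    by (intro tendsto_scaleR filterlim_fst filterlim_snd)
qed

text \<open>
  The library constant \<^const>\<open>bounded\<close> refers to a metric. In a topological vector space a
  set is bounded if it is absorbed by every neighbourhood of the origin.
\<close>

definition tvs_bounded :: "'a::topological_real_vector set \<Rightarrow> bool" where
  "tvs_bounded C \<longleftrightarrow>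
     (\<forall>U. open U \<and> 0 \<in> U \<longrightarrow> (\<exists>s>0. \<forall>t>s. C \<subseteq> (\<lambda>x. t *\<^sub>R x) ` U))"

lemma tvs_bounded_iff_bounded:
  fixes C :: "'a::real_normed_vector set"
  shows "tvs_bounded C \<longleftrightarrow> bounded C"
proof
  assume *: "tvs_bounded C"
  have "open (ball (0::'a) 1)" "(0::'a) \<in> ball 0 1"
    by auto
  then obtain s :: real where s: "s > 0" "\<forall>t>s. C \<subseteq> (\<lambda>x. t *\<^sub>R x) ` ball 0 1"
    using * unfolding tvs_bounded_def by meson
  then have "C \<subseteq> (\<lambda>x. (s + 1) *\<^sub>R x) ` ball 0 1"
    by simp
  then show "bounded C"
    using bounded_scaling[OF bounded_ball] bounded_subset by blast
next
  assume "bounded C"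
  then obtain b where b: "b > 0" "\<And>x. x \<in> C \<Longrightarrow> norm x \<le> b"
    using bounded_pos by blast
  show "tvs_bounded C"
    unfolding tvs_bounded_def
  proof (intro allI impI)
    fix U :: "'a set"
    assume "open U \<and> 0 \<in> U"
    then obtain e where e: "e > 0" "ball 0 e \<subseteq> U"
      using open_contains_ball by blast
    have "C \<subseteq> (\<lambda>x. t *\<^sub>R x) ` U" if t: "t > b / e" for t
    proof
      fix x assume "x \<in> C"
      have "t > 0"
        using t b(1) e(1) by (meson divide_pos_pos less_trans)
      have "norm x < t * e"
        using b(2)[OF \<open>x \<in> C\<close>] t e(1) by (simp add: pos_divide_less_eq)
      then have "(1 / t) *\<^sub>R x \<in> U"
        using e \<open>t > 0\<close> by (intro subsetD[OF e(2)]) (simp add: field_simps)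
      then show "x \<in> (\<lambda>x. t *\<^sub>R x) ` U"
        using \<open>t > 0\<close> by (intro image_eqI[of _ _ "(1 / t) *\<^sub>R x"]) auto
    qed
    then show "\<exists>s>0. \<forall>t>s. C \<subseteq> (\<lambda>x. t *\<^sub>R x) ` U"
      using b(1) e(1) by (intro exI[of _ "b / e"]) auto
  qed
qed

definition topological_dual :: "('a::topological_real_vector \<Rightarrow> real) set" where
  "topological_dual = {\<phi>. linear \<phi> \<and> continuous_on UNIV \<phi>}"

definition weak_AFPP_set :: "'a::{topological_real_vector, t2_space} set \<Rightarrow> bool" where
  "weak_AFPP_set C \<longleftrightarrow>
     (\<forall>f. continuous_on C f \<and> f ` C \<subseteq> C \<longrightarrow>
        (\<exists>x::nat \<Rightarrow> 'a. (\<forall>n. x n \<in> C) \<and>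
           (\<forall>\<phi>\<in>topological_dual. (\<lambda>n. \<phi> (x n - f (x n))) \<longlonglongrightarrow> 0)))"

definition weak_AFPP :: "'a::{topological_real_vector, t2_space} itself \<Rightarrow> bool" where
  "weak_AFPP (_ :: 'a itself) \<longleftrightarrow>
     (\<forall>C::'a set. C \<noteq> {} \<and> tvs_bounded C \<and> closed C \<and> convex C \<longrightarrow> weak_AFPP_set C)"

text \<open>
  The space of finitely supported real sequences with the $\ell_1$-norm is the type
  \<^typ>\<open>nat \<Rightarrow>\<^sub>0 real\<close>: its library metric is the $\ell_1$-distance
  (see \<open>dist_poly_mapping_def\<close>). Coordinates are indexed from 0.
\<close>

definition ell1_map :: "(nat \<Rightarrow> 'a::real_vector) \<Rightarrow> (nat \<Rightarrow>\<^sub>0 real) \<Rightarrow> 'a" where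
  "ell1_map x a = (\<Sum>i\<in>Poly_Mapping.keys a. Poly_Mapping.lookup a i *\<^sub>R x i)"

lemma ell1_map_superset:
  assumes "finite I" "Poly_Mapping.keys a \<subseteq> I"
  shows "ell1_map x a = (\<Sum>i\<in>I. Poly_Mapping.lookup a i *\<^sub>R x i)"
  unfolding ell1_map_def using assms
  by (intro sum.mono_neutral_left) (auto simp: in_keys_iff)

lemma lookup_scaleR_poly_mapping:
  fixes a :: "'b \<Rightarrow>\<^sub>0 'a::real_vector"
  shows "Poly_Mapping.lookup (c *\<^sub>R a) i = c *\<^sub>R Poly_Mapping.lookup a i"
proof -
  have "finite {i. c *\<^sub>R Poly_Mapping.lookup a i \<noteq> 0}"
    by (rule finite_subset[OF _ finite_lookup[of a]]) auto
  then show ?thesis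
    by (simp add: scaleR_poly_mapping_def)
qed

lemma linear_ell1_map: "linear (ell1_map x)"
proof
  fix a b :: "nat \<Rightarrow>\<^sub>0 real"
  let ?I = "Poly_Mapping.keys a \<union> Poly_Mapping.keys b"
  have "Poly_Mapping.keys (a + b) \<subseteq> ?I"
    by (rule Poly_Mapping.keys_add)
  then show "ell1_map x (a + b) = ell1_map x a + ell1_map x b"
    by (simp add: ell1_map_superset[of ?I] lookup_add scaleR_add_left sum.distrib)
next
  fix c :: real and a :: "nat \<Rightarrow>\<^sub>0 real"
  have "Poly_Mapping.keys (c *\<^sub>R a) \<subseteq> Poly_Mapping.keys a"
    by (auto simp: in_keys_iff lookup_scaleR_poly_mapping)
  then show "ell1_map x (c *\<^sub>R a) = c *\<^sub>R ell1_map x a"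
    by (simp add: ell1_map_superset[of "Poly_Mapping.keys a"] lookup_scaleR_poly_mapping
        scaleR_sum_right)
qed

definition ell1_sequence :: "(nat \<Rightarrow> 'a::topological_real_vector) \<Rightarrow> bool" where
  "ell1_sequence x \<longleftrightarrow> linear (ell1_map x) \<and>
     (\<exists>g. homeomorphism UNIV (range (ell1_map x)) (ell1_map x) g)"

end

theory Submission
  imports Defs
begin

text \<open>
  Brouwer's theorem, applied to finitely many functionals at a time, shows that the origin lies in
  the weak closure of \<open>A = {x - f x | x. x \<in> C}\<close>. It remains to replace nets by sequences. The dual is
  an increasing union of polars \<open>K n\<close>, which are compact for pointwise convergence. Given \<open>\<epsilon> > 0\<close>,
  a point \<open>a\<close> splits a set \<open>L\<close> of functionals into the halves where \<open>k a \<ge> \<epsilon>\<close> and where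
  \<open>k a \<le> \<epsilon> / 2\<close>. By Rosenthal's criterion, a sequence in \<open>A\<close> whose iterated halves of \<open>K n\<close> are
  all nonempty is an \<open>\<ell>\<^sub>1\<close>-sequence, so in its absence repeated halving is a well-founded process.
  Induction along it extracts, from any \<open>B \<subseteq> A\<close> with the origin in its weak closure, a subset \<open>D\<close>
  with the same property such that \<open>{a \<in> D. k a \<ge> \<epsilon>}\<close> is finite for every \<open>k \<in> K n\<close>. A diagonal set
  over \<open>\<epsilon>\<close> and \<open>n\<close> is then enumerated by a weakly null sequence.
\<close>

section \<open>Approximate fixed points for finitely many functionals\<close>

text \<open>Freezing the coordinates from \<open>n\<close> on at 0 puts the cubes of all dimensions
  into one type, as compact sets for its product topology.\<close>

definition nat_cube :: "nat \<Rightarrow> (nat \<Rightarrow> real) set" where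
  "nat_cube n = (\<Pi>\<^sub>E i\<in>UNIV. if i < n then {0..1} else {0})"

lemma mem_nat_cube:
  "y \<in> nat_cube n \<longleftrightarrow> (\<forall>i<n. 0 \<le> y i \<and> y i \<le> 1) \<and> (\<forall>i\<ge>n. y i = 0)"
  by (auto simp: nat_cube_def PiE_iff not_less[symmetric])

text \<open>Tychonoff's theorem; it serves the cubes, the powers of a compact set of functionals and
  the polars.\<close>

lemma compact_PiE_UNIV:
  fixes S :: "'i \<Rightarrow> 'b::topological_space set"
  assumes "\<And>i. compact (S i)"
  shows "compact (\<Pi>\<^sub>E i\<in>UNIV. S i)"
proof -
  have "compactin (product_topology (\<lambda>i. euclidean) UNIV) (\<Pi>\<^sub>E i\<in>UNIV. S i)"
    using assms by (simp add: compactin_PiE)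
  then show ?thesis
    by (simp add: euclidean_product_topology)
qed

lemma compact_nat_cube: "compact (nat_cube n)"
  unfolding nat_cube_def by (rule compact_PiE_UNIV) auto

lemma tendsto_coordinatewise_iff:
  fixes f :: "'c \<Rightarrow> 'i \<Rightarrow> 'b::topological_space"
  shows "(f \<longlongrightarrow> l) F \<longleftrightarrow> (\<forall>i. ((\<lambda>x. f x i) \<longlongrightarrow> l i) F)"
  using limitin_componentwise[of "\<lambda>i. euclidean" UNIV f l F]
  by (simp add: euclidean_product_topology)

text \<open>
  The library states Brouwer's theorem for types of class \<open>euclidean_space\<close>; here the dimension
  is the number of functionals, a variable of the proof, so Kuhn's lemma is used directly.
\<close>

theorem Brouwer_nat_cube:
  fixes g :: "(nat \<Rightarrow> real) \<Rightarrow> nat \<Rightarrow> real"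
  assumes cont: "\<And>i. i < n \<Longrightarrow> continuous_on (nat_cube n) (\<lambda>y. g y i)"
    and maps: "\<And>y i. y \<in> nat_cube n \<Longrightarrow> i < n \<Longrightarrow> 0 \<le> g y i \<and> g y i \<le> 1"
  obtains y where "y \<in> nat_cube n" "\<And>i. i < n \<Longrightarrow> g y i = y i"
proof -
  define pt :: "nat \<Rightarrow> (nat \<Rightarrow> nat) \<Rightarrow> nat \<Rightarrow> real" where
    "pt = (\<lambda>p x i. if i < n then real (x i) / real p else 0)"
  have pt_cube: "pt p x \<in> nat_cube n" if "0 < p" "\<forall>i<n. x i \<le> p" for p x
    using that by (auto simp: pt_def mem_nat_cube)
  \<comment> \<open>Brouwer's theorem at mesh \<open>1 / Suc m\<close>: for each coordinate
    \<open>i\<close>, close to \<open>z\<close> there is a point where \<open>g\<close> does not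
    lower coordinate \<open>i\<close> and another where it does not raise it. Compactness then lets
    the mesh tend to 0.\<close>
  have cell: "\<exists>z\<in>nat_cube n. \<forall>i<n. \<exists>r\<in>nat_cube n. \<exists>s\<in>nat_cube n.
      (\<forall>j. \<bar>r j - z j\<bar> \<le> 1 / Suc m \<and> \<bar>s j - z j\<bar> \<le> 1 / Suc m) \<and> r i \<le> g r i \<and> g s i \<le> s i" for m
  proof -
    let ?p = "Suc m"
    \<comment> \<open>Label 0 stands for \<open>pt ?p x i \<le> g (pt ?p x) i\<close>, label 1 for
      the reverse inequality. On opposite faces the labels are forced to be 0 and 1, as Kuhn's lemma
      demands; the inequalities hold there because \<open>g\<close> has values between 0 and
      1.\<close>
    define label :: "(nat \<Rightarrow> nat) \<Rightarrow> nat \<Rightarrow> nat" where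
      "label = (\<lambda>x i. if x i = ?p \<or> (x i \<noteq> 0 \<and> g (pt ?p x) i < pt ?p x i) then 1 else 0)"
    obtain q where q: "\<forall>i<n. q i < ?p"
      and rs: "\<forall>i<n. \<exists>r s. (\<forall>j<n. q j \<le> r j \<and> r j \<le> q j + 1) \<and>
          (\<forall>j<n. q j \<le> s j \<and> s j \<le> q j + 1) \<and> label r i \<noteq> label s i"
      by (rule kuhn_lemma[of ?p n label]) (auto simp: label_def)
    have near: "\<bar>pt ?p r j - pt ?p q j\<bar> \<le> 1 / ?p" if "\<forall>j<n. q j \<le> r j \<and> r j \<le> q j + 1" for r j
    proof (cases "j < n")
      case True
      then have "real (q j) \<le> real (r j)" "real (r j) \<le> real (q j) + 1"
        using that by (fastforce simp: of_nat_le_iff simp flip: of_nat_Suc)+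
      then have "0 \<le> real (r j) - real (q j)" "real (r j) - real (q j) \<le> 1"
        by auto
      then show ?thesis
        using True by (simp add: pt_def divide_right_mono flip: diff_divide_distrib)
    qed (simp add: pt_def)
    have inc: "pt ?p r \<in> nat_cube n" if "\<forall>j<n. q j \<le> r j \<and> r j \<le> q j + 1" for r
      using that q by (intro pt_cube) (auto simp: less_Suc_eq_le intro: order_trans)
    have lab0: "pt ?p r i \<le> g (pt ?p r) i" if "pt ?p r \<in> nat_cube n" "i < n" "label r i = 0" for r i
    proof (cases "r i = 0")
      case True
      then show ?thesis
        using maps[OF that(1,2)] by (simp add: pt_def that(2))
    qed (use that in \<open>auto simp: label_def split: if_splits\<close>)
    have lab1: "g (pt ?p r) i \<le> pt ?p r i" if "pt ?p r \<in> nat_cube n" "i < n" "label r i \<noteq> 0" for r i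
    proof (cases "r i = ?p")
      case True
      then show ?thesis
        using maps[OF that(1,2)] by (simp add: pt_def that(2))
    qed (use that in \<open>auto simp: label_def split: if_splits\<close>)
    show ?thesis
    proof (rule bexI[of _ "pt ?p q"], intro allI impI)
      fix i assume i: "i < n"
      obtain r s where r: "\<forall>j<n. q j \<le> r j \<and> r j \<le> q j + 1"
        and s: "\<forall>j<n. q j \<le> s j \<and> s j \<le> q j + 1" and ne: "label r i \<noteq> label s i"
        using rs i by blast
      have "label r i = 0 \<and> label s i \<noteq> 0 \<or> label s i = 0 \<and> label r i \<noteq> 0"
        using ne by (auto simp: label_def split: if_splits)
      then obtain r' s' where r': "\<forall>j<n. q j \<le> r' j \<and> r' j \<le> q j + 1"
        and s': "\<forall>j<n. q j \<le> s' j \<and> s' j \<le> q j + 1" and l: "label r' i = 0" "label s' i \<noteq> 0"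
        using r s by blast
      show "\<exists>r\<in>nat_cube n. \<exists>s\<in>nat_cube n.
          (\<forall>j. \<bar>r j - pt ?p q j\<bar> \<le> 1 / ?p \<and> \<bar>s j - pt ?p q j\<bar> \<le> 1 / ?p) \<and> r i \<le> g r i \<and> g s i \<le> s i"
        using near[OF r'] near[OF s'] inc[OF r'] inc[OF s'] lab0[OF inc[OF r'] i l(1)]
          lab1[OF inc[OF s'] i l(2)] by blast
    qed (rule inc, simp)
  qed
  then obtain z where z: "\<And>m. z m \<in> nat_cube n"
    and "\<And>m. \<forall>i<n. \<exists>r\<in>nat_cube n. \<exists>s\<in>nat_cube n.
      (\<forall>j. \<bar>r j - z m j\<bar> \<le> 1 / Suc m \<and> \<bar>s j - z m j\<bar> \<le> 1 / Suc m) \<and> r i \<le> g r i \<and> g s i \<le> s i"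
    by metis
  then have "\<forall>m i. \<exists>r s. i < n \<longrightarrow> r \<in> nat_cube n \<and> s \<in> nat_cube n \<and>
      (\<forall>j. \<bar>r j - z m j\<bar> \<le> 1 / Suc m \<and> \<bar>s j - z m j\<bar> \<le> 1 / Suc m) \<and> r i \<le> g r i \<and> g s i \<le> s i"
    by blast
  then obtain r s where rs: "\<And>m i. i < n \<Longrightarrow> r m i \<in> nat_cube n \<and> s m i \<in> nat_cube n \<and>
      (\<forall>j. \<bar>r m i j - z m j\<bar> \<le> 1 / Suc m \<and> \<bar>s m i j - z m j\<bar> \<le> 1 / Suc m) \<and>
      r m i i \<le> g (r m i) i \<and> g (s m i) i \<le> s m i i"
    by metis
  obtain y \<sigma> where y: "y \<in> nat_cube n" and \<sigma>: "strict_mono (\<sigma>::nat \<Rightarrow> nat)" and lim: "(z \<circ> \<sigma>) \<longlonglongrightarrow> y"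
    using seq_compactE[OF compact_imp_seq_compact[OF compact_nat_cube]] z by metis
  have null: "(\<lambda>m. 1 / Suc (\<sigma> m)) \<longlonglongrightarrow> (0::real)"
    using LIMSEQ_subseq_LIMSEQ[OF LIMSEQ_Suc[OF lim_1_over_n] \<sigma>] by (simp add: o_def)
  have near: "(\<lambda>m. w (\<sigma> m)) \<longlonglongrightarrow> y"
    if "\<And>m j. \<bar>w m j - z m j\<bar> \<le> 1 / Suc m" for w :: "nat \<Rightarrow> nat \<Rightarrow> real"
    unfolding tendsto_coordinatewise_iff
  proof
    fix j
    have "(\<lambda>m. w (\<sigma> m) j - z (\<sigma> m) j) \<longlonglongrightarrow> 0"
      by (rule Lim_null_comparison[OF _ null]) (use that in auto)
    moreover have "(\<lambda>m. z (\<sigma> m) j) \<longlonglongrightarrow> y j"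
      using lim by (simp add: tendsto_coordinatewise_iff)
    ultimately show "(\<lambda>m. w (\<sigma> m) j) \<longlonglongrightarrow> y j"
      using tendsto_add by fastforce
  qed
  have "g y i = y i" if i: "i < n" for i
  proof (rule antisym)
    have "(\<lambda>m. s (\<sigma> m) i) \<longlonglongrightarrow> y"
      using rs[OF i] by (intro near) blast
    moreover have "(\<lambda>m. g (s (\<sigma> m) i) i) \<longlonglongrightarrow> g y i"
      by (rule continuous_on_tendsto_compose[OF cont[OF i] calculation y]) (use rs[OF i] in auto)
    ultimately show "g y i \<le> y i"
      using rs[OF i] by (intro LIMSEQ_le[of "\<lambda>m. g (s (\<sigma> m) i) i" _ "\<lambda>m. s (\<sigma> m) i i"])
        (auto simp: tendsto_coordinatewise_iff)
    have "(\<lambda>m. r (\<sigma> m) i) \<longlonglongrightarrow> y"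
      using rs[OF i] by (intro near) blast
    moreover have "(\<lambda>m. g (r (\<sigma> m) i) i) \<longlonglongrightarrow> g y i"
      by (rule continuous_on_tendsto_compose[OF cont[OF i] calculation y]) (use rs[OF i] in auto)
    ultimately show "y i \<le> g y i"
      using rs[OF i] by (intro LIMSEQ_le[of "\<lambda>m. r (\<sigma> m) i i" _ "\<lambda>m. g (r (\<sigma> m) i) i"])
        (auto simp: tendsto_coordinatewise_iff)
  qed
  then show thesis
    using that y by blast
qed

section \<open>Schauder projections in bounded convex sets\<close>

lemma tendsto_scaleR_tvs:
  fixes g :: "'b \<Rightarrow> 'a::topological_real_vector"
  assumes "(f \<longlongrightarrow> a) F" "(g \<longlongrightarrow> b) F"
  shows "((\<lambda>x. f x *\<^sub>R g x) \<longlongrightarrow> a *\<^sub>R b) F"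
  using filterlim_compose[OF tendsto_scaleR_Pair, of "\<lambda>x. (f x, g x)" a b F] assms
  by (simp add: nhds_prod[symmetric] tendsto_Pair)

lemma continuous_on_scaleR_tvs:
  fixes g :: "'b::topological_space \<Rightarrow> 'a::topological_real_vector"
  assumes "continuous_on S f" "continuous_on S g"
  shows "continuous_on S (\<lambda>x. f x *\<^sub>R g x)"
  using assms unfolding continuous_on_def by (auto intro: tendsto_scaleR_tvs)

lemma topological_dual_bounded_on:
  assumes "tvs_bounded C" "\<phi> \<in> topological_dual"
  obtains M where "0 < M" "\<And>x. x \<in> C \<Longrightarrow> \<bar>\<phi> x\<bar> \<le> M"
proof -
  have lin: "linear \<phi>" and cont: "continuous_on UNIV \<phi>"
    using assms(2) by (auto simp: topological_dual_def)
  let ?U = "{x. \<bar>\<phi> x\<bar> < 1}"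
  have "open ?U" "0 \<in> ?U"
    using cont lin by (auto intro!: open_Collect_less continuous_intros simp: linear_0)
  then obtain s where s: "s > 0" "\<forall>t>s. C \<subseteq> (\<lambda>x. t *\<^sub>R x) ` ?U"
    using assms(1) unfolding tvs_bounded_def by meson
  then have sub: "C \<subseteq> (\<lambda>x. (s + 1) *\<^sub>R x) ` ?U"
    by simp
  have "\<bar>\<phi> x\<bar> \<le> s + 1" if "x \<in> C" for x
  proof -
    obtain u where "\<bar>\<phi> u\<bar> < 1" "x = (s + 1) *\<^sub>R u"
      using sub \<open>x \<in> C\<close> by auto
    then show ?thesis
      using s(1) by (simp add: linear_scale[OF lin] abs_mult)
  qed
  then show thesis
    using s(1) by (intro that[of "s + 1"]) auto
qed

text \<open>\<open>C\<close> need not be compact, but its image under finitely many bounded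
  functions is totally bounded. One point is kept from each occupied cell of a grid of width
  \<open>1 / N\<close>; two points of a cell differ by at most \<open>k / N < e\<close> in the
  sum.\<close>

lemma finite_grid_net:
  fixes \<psi> :: "nat \<Rightarrow> 'a \<Rightarrow> real"
  assumes "\<And>i x. i < k \<Longrightarrow> x \<in> C \<Longrightarrow> 0 \<le> \<psi> i x \<and> \<psi> i x \<le> 1" and "0 < e"
  obtains S where "finite S" "S \<subseteq> C"
    "\<And>x. x \<in> C \<Longrightarrow> \<exists>s\<in>S. (\<Sum>i<k. \<bar>\<psi> i s - \<psi> i x\<bar>) < e"
proof -
  obtain N :: nat where N: "real k / e < real N" "0 < N"
  proof -
    obtain N0 :: nat where "real k / e < real N0"
      using reals_Archimedean2 by blast
    then show thesis
      by (intro that[of "Suc N0"]) auto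
  qed
  define cell where "cell = (\<lambda>x. restrict (\<lambda>i. \<lfloor>real N * \<psi> i x\<rfloor>) {..<k})"
  have "cell ` C \<subseteq> ({..<k} \<rightarrow>\<^sub>E {0..int N})"
  proof -
    have "0 \<le> \<lfloor>real N * \<psi> i x\<rfloor> \<and> \<lfloor>real N * \<psi> i x\<rfloor> \<le> int N" if "i < k" "x \<in> C" for i x
      using assms(1)[OF that] floor_mono[of "real N * \<psi> i x" "real N"]
      by (simp add: mult_left_le)
    then show ?thesis
      unfolding cell_def image_subset_iff restrict_PiE_iff atLeastAtMost_iff lessThan_iff by blast
  qed
  moreover have "finite ({..<k} \<rightarrow>\<^sub>E {0..int N})"
    by (intro finite_PiE) auto
  ultimately have "finite (cell ` C)"
    by (rule finite_subset)
  then obtain S where S: "S \<subseteq> C" "finite S" "cell ` C = cell ` S"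
    using finite_subset_image[OF \<open>finite (cell ` C)\<close> order_refl] by blast
  have "\<exists>s\<in>S. (\<Sum>i<k. \<bar>\<psi> i s - \<psi> i x\<bar>) < e" if "x \<in> C" for x
  proof -
    obtain s where s: "s \<in> S" "cell x = cell s"
      using S(3) \<open>x \<in> C\<close> by (metis imageE imageI)
    have "\<bar>\<psi> i s - \<psi> i x\<bar> \<le> 1 / real N" if "i < k" for i
    proof -
      have "\<lfloor>real N * \<psi> i x\<rfloor> = \<lfloor>real N * \<psi> i s\<rfloor>"
        using fun_cong[OF s(2), of i] that by (simp add: cell_def)
      then have "\<bar>real N * \<psi> i s - real N * \<psi> i x\<bar> \<le> 1"
        by linarith
      then have "real N * \<bar>\<psi> i s - \<psi> i x\<bar> \<le> 1"
        by (simp add: abs_mult flip: right_diff_distrib)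
      then show ?thesis
        using N(2) by (simp add: pos_le_divide_eq mult.commute)
    qed
    then have "(\<Sum>i<k. \<bar>\<psi> i s - \<psi> i x\<bar>) \<le> (\<Sum>i<k. 1 / real N)"
      by (intro sum_mono) auto
    also have "\<dots> < e"
      using N assms(2) by (simp add: pos_divide_less_eq mult.commute)
    finally show ?thesis
      using s(1) by blast
  qed
  with S(2,1) show thesis
    by (rule that)
qed

text \<open>As \<open>f\<close> is continuous only for the original topology, it cannot be pushed
  down to the values of the functionals. Instead \<open>R\<close> sends the cube into the convex
  hull of a finite net, continuously for the original topology, and Brouwer's theorem applies to
  \<open>y \<mapsto> \<psi>(f (R y))\<close>. At a fixed point \<open>y\<close>, the values of
  \<open>\<psi>\<close> at \<open>R y\<close> are close to \<open>y\<close>, which are its values at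
  \<open>f (R y)\<close>.\<close>

theorem approximate_fixed_point:
  fixes C :: "'a::topological_real_vector set"
  assumes C: "convex C" "C \<noteq> {}" "tvs_bounded C"
    and f: "continuous_on C f" "f ` C \<subseteq> C"
    and \<Phi>: "finite \<Phi>" "\<Phi> \<subseteq> topological_dual" and "0 < \<epsilon>"
  shows "\<exists>x\<in>C. \<forall>\<phi>\<in>\<Phi>. \<bar>\<phi> (x - f x)\<bar> < \<epsilon>"
proof -
  obtain h :: "nat \<Rightarrow> 'a \<Rightarrow> real" and k where h: "\<Phi> = h ` {i. i < k}"
    using finite_imp_nat_seg_image_inj_on[OF \<Phi>(1)] by blast
  have dual: "linear (h i)" "continuous_on UNIV (h i)" "h i \<in> topological_dual" if "i < k" for i
    using \<Phi>(2) that h by (auto simp: topological_dual_def)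
  have "\<exists>M>0. \<forall>x\<in>C. \<bar>h i x\<bar> \<le> M" if "i < k" for i
    using topological_dual_bounded_on[OF C(3) dual(3)[OF that]] by metis
  then obtain m where m: "\<And>i. i < k \<Longrightarrow> 0 < m i \<and> (\<forall>x\<in>C. \<bar>h i x\<bar> \<le> m i)"
    by metis
  \<comment> \<open>A common bound for all functionals; the summand 1 keeps it positive when there
    are none.\<close>
  define M where "M = 1 + (\<Sum>i<k. m i)"
  have m_le: "m i \<le> M" if "i < k" for i
    using member_le_sum[of i "{..<k}" m] m that unfolding M_def by fastforce
  have "0 \<le> (\<Sum>i<k. m i)"
    using m by (intro sum_nonneg) (auto intro: less_imp_le)
  then have "0 < M"
    by (simp add: M_def)
  have hM: "\<bar>h i x\<bar> \<le> M" if "i < k" "x \<in> C" for i x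
    using m[OF that(1)] m_le[OF that(1)] that(2) by fastforce
  \<comment> \<open>This rescales \<open>[-M, M]\<close> to \<open>[0, 1]\<close>, so that the
    functionals map \<open>C\<close> into the unit cube.\<close>
  define \<psi> where "\<psi> = (\<lambda>i x. (h i x / M + 1) / 2)"
  have \<psi>: "0 \<le> \<psi> i x \<and> \<psi> i x \<le> 1" if "i < k" "x \<in> C" for i x
    using hM[OF that] \<open>0 < M\<close> by (simp add: \<psi>_def abs_le_iff field_simps)
  \<comment> \<open>Undoing the rescaling costs a factor \<open>2 * M\<close> and the projection an
    error \<open>2 * e\<close>; the product is \<open>\<epsilon> / 2\<close>.\<close>
  define e where "e = \<epsilon> / (8 * M)"
  have "0 < e"
    using \<open>0 < M\<close> \<open>0 < \<epsilon>\<close> by (simp add: e_def)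
  obtain S where S: "finite S" "S \<subseteq> C"
    and net: "\<And>x. x \<in> C \<Longrightarrow> \<exists>s\<in>S. (\<Sum>i<k. \<bar>\<psi> i s - \<psi> i x\<bar>) < e"
    using finite_grid_net[of k C \<psi> e] \<psi> \<open>0 < e\<close> by blast
  obtain x0 where x0: "x0 \<in> S"
    using net C(2) by blast
  \<comment> \<open>The weight \<open>w s\<close> lives on the \<open>2 * e\<close>-ball around the
    image of the net point \<open>s\<close>. A point of the cube may be far from all these images,
    so \<open>v\<close> adds weight at \<open>x0\<close> to keep the total \<open>L\<close>
    positive. It vanishes as soon as some \<open>D s y < e\<close>, since then
    \<open>w s y > e\<close>.\<close>
  define D where "D = (\<lambda>s y. \<Sum>i<k. \<bar>\<psi> i s - y i\<bar>)"
  define w where "w = (\<lambda>s y. max 0 (2 * e - D s y))"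
  define v where "v = (\<lambda>y. max 0 (e - (\<Sum>s\<in>S. w s y)))"
  define l where "l = (\<lambda>s y. w s y + (if s = x0 then v y else 0))"
  define L where "L = (\<lambda>y. \<Sum>s\<in>S. l s y)"
  define R where "R = (\<lambda>y. \<Sum>s\<in>S. (l s y / L y) *\<^sub>R s)"
  have L_eq: "L y = (\<Sum>s\<in>S. w s y) + v y" for y
    using S(1) x0 by (simp add: L_def l_def sum.distrib)
  have "0 < L y" for y
    unfolding L_eq using \<open>0 < e\<close> by (auto simp: v_def max_def)
  have l_nonneg: "0 \<le> l s y" for s y
    by (simp add: l_def w_def v_def)
  have sum1: "(\<Sum>s\<in>S. l s y / L y) = 1" for y
    using \<open>0 < L y\<close> by (simp add: L_def flip: sum_divide_distrib)
  have RC: "R y \<in> C" for y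
    unfolding R_def using S l_nonneg \<open>0 < L y\<close> sum1
    by (intro convex_sum C(1)) (auto intro: divide_nonneg_pos)
  have contD: "continuous_on UNIV (D s)" for s
    unfolding D_def by (intro continuous_intros) (auto intro: continuous_on_product_coordinates)
  have contw: "continuous_on UNIV (w s)" for s
    unfolding w_def by (intro continuous_intros contD)
  have contv: "continuous_on UNIV v"
    unfolding v_def by (intro continuous_intros contw)
  have contl: "continuous_on UNIV (l s)" for s
    unfolding l_def by (cases "s = x0") (auto intro!: continuous_intros contw contv)
  have contR: "continuous_on UNIV R"
    unfolding R_def
  proof (intro continuous_on_sum continuous_on_scaleR_tvs continuous_on_divide contl continuous_on_const ballI)
    show "continuous_on UNIV L"
      unfolding L_def by (intro continuous_intros contl)
    show "L y \<noteq> 0" for y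
      using \<open>0 < L y\<close> by simp
  qed
  define g where "g = (\<lambda>y i. \<psi> i (f (R y)))"
  have "\<exists>y. \<forall>i<k. g y i = y i"
  proof (rule Brouwer_nat_cube[of k g])
    show "continuous_on (nat_cube k) (\<lambda>y. g y i)" if "i < k" for i
    proof -
      have "continuous_on UNIV (\<lambda>y. f (R y))"
        using contR RC by (intro continuous_on_compose2[OF f(1)]) auto
      then have "continuous_on UNIV (\<lambda>y. h i (f (R y)))"
        by (intro continuous_on_compose2[OF dual(2)[OF that]]) auto
      then show ?thesis
        unfolding g_def \<psi>_def using \<open>0 < M\<close>
        by (intro continuous_intros) (auto intro: continuous_on_subset)
    qed
    show "0 \<le> g y i \<and> g y i \<le> 1" if "i < k" for y i
      unfolding g_def using \<psi>[OF that] RC f(2) by blast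
  qed blast
  then obtain y where y: "\<And>i. i < k \<Longrightarrow> g y i = y i"
    by blast
  let ?x = "R y"
  have fC: "f ?x \<in> C"
    using RC f(2) by blast
  \<comment> \<open>The fixed point \<open>y\<close> is the image of a point of \<open>C\<close>,
    namely \<open>f ?x\<close>, so the net comes within \<open>e\<close> of it. Hence
    \<open>v y = 0\<close> and only net points within \<open>2 * e\<close> of \<open>y\<close> carry
    weight.\<close>
  obtain s where s: "s \<in> S" "D s y < e"
  proof -
    obtain s where "s \<in> S" "(\<Sum>i<k. \<bar>\<psi> i s - \<psi> i (f ?x)\<bar>) < e"
      using net[OF fC] by blast
    moreover have "(\<Sum>i<k. \<bar>\<psi> i s - \<psi> i (f ?x)\<bar>) = D s y"
      unfolding D_def using y by (intro sum.cong) (auto simp: g_def)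
    ultimately show thesis
      using that by simp
  qed
  have "w s y \<le> (\<Sum>s\<in>S. w s y)"
    using S(1) s(1) by (intro member_le_sum) (auto simp: w_def)
  then have v0: "v y = 0"
    using s(2) by (simp add: v_def w_def)
  have close: "\<bar>\<psi> i ?x - y i\<bar> \<le> 2 * e" if i: "i < k" for i
  proof -
    \<comment> \<open>\<open>\<psi> i\<close> is affine and the weights sum to 1, so it commutes
      with this convex combination.\<close>
    have "\<psi> i ?x = (\<Sum>s\<in>S. l s y / L y * \<psi> i s)"
    proof -
      have split: "t * ((a / M + 1) / 2) = t * a / (2 * M) + t / 2" for t a
        using \<open>0 < M\<close> by (simp add: field_simps)
      have "(\<Sum>s\<in>S. l s y / L y * \<psi> i s) = (\<Sum>s\<in>S. (l s y / L y * h i s) / (2 * M) + (l s y / L y) / 2)"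
        unfolding \<psi>_def by (intro sum.cong refl split)
      also have "\<dots> = (\<Sum>s\<in>S. l s y / L y * h i s) / (2 * M) + (\<Sum>s\<in>S. l s y / L y) / 2"
        by (simp only: sum.distrib sum_divide_distrib)
      also have "(\<Sum>s\<in>S. l s y / L y * h i s) = h i ?x"
        by (simp add: R_def linear_sum[OF dual(1)[OF i]] linear_scale[OF dual(1)[OF i]])
      finally show ?thesis
        using sum1 by (simp add: \<psi>_def field_simps)
    qed
    moreover have "y i = (\<Sum>s\<in>S. l s y / L y * y i)"
      using sum_distrib_right[of "\<lambda>s. l s y / L y" S "y i"] sum1[of y] by simp
    ultimately have "\<psi> i ?x - y i = (\<Sum>s\<in>S. l s y / L y * (\<psi> i s - y i))"
      by (simp add: right_diff_distrib sum_subtractf)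
    also have "\<bar>\<dots>\<bar> \<le> (\<Sum>s\<in>S. l s y / L y * (2 * e))"
    proof (rule order_trans[OF sum_abs sum_mono])
      fix s assume "s \<in> S"
      show "\<bar>l s y / L y * (\<psi> i s - y i)\<bar> \<le> l s y / L y * (2 * e)"
      proof (cases "l s y = 0")
        case False
        then have "D s y \<le> 2 * e"
          using v0 by (simp add: l_def w_def max_def split: if_splits)
        moreover have "\<bar>\<psi> i s - y i\<bar> \<le> D s y"
          unfolding D_def using i by (intro member_le_sum[of i "{..<k}" "\<lambda>i. \<bar>\<psi> i s - y i\<bar>"]) auto
        ultimately have "\<bar>\<psi> i s - y i\<bar> \<le> 2 * e"
          by simp
        moreover have "0 \<le> l s y / L y"
          using l_nonneg \<open>0 < L y\<close> by (simp add: divide_nonneg_pos)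
        ultimately show ?thesis
          by (metis abs_mult abs_of_nonneg mult_left_mono)
      qed simp
    qed
    also have "\<dots> = 2 * e"
      by (simp only: sum1 mult_1 flip: sum_distrib_right)
    finally show ?thesis .
  qed
  have "\<bar>\<phi> (?x - f ?x)\<bar> < \<epsilon>" if "\<phi> \<in> \<Phi>" for \<phi>
  proof -
    obtain i where i: "i < k" "\<phi> = h i"
      using h \<open>\<phi> \<in> \<Phi>\<close> by blast
    have "\<phi> (?x - f ?x) = 2 * M * (\<psi> i ?x - \<psi> i (f ?x))"
      using \<open>0 < M\<close> by (simp add: \<psi>_def i(2) linear_diff[OF dual(1)[OF i(1)]] field_simps)
    also have "\<psi> i (f ?x) = y i"
      using y[OF i(1)] by (simp add: g_def)
    finally have "\<bar>\<phi> (?x - f ?x)\<bar> = 2 * M * \<bar>\<psi> i ?x - y i\<bar>"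
      using \<open>0 < M\<close> by (simp add: abs_mult)
    also have "\<dots> \<le> 2 * M * (2 * e)"
      using close[OF i(1)] \<open>0 < M\<close> by (intro mult_left_mono) auto
    also have "\<dots> < \<epsilon>"
      using \<open>0 < M\<close> \<open>0 < \<epsilon>\<close> by (simp add: e_def)
    finally show ?thesis .
  qed
  then show ?thesis
    using RC by blast
qed

section \<open>Extraction of weakly null sequences\<close>

text \<open>For linear functionals \<open>\<K>\<close> on a vector space: the origin lies in the
  closure of \<open>B\<close> for the weak topology that \<open>\<K>\<close> induces.\<close>

definition adherent_zero :: "('a \<Rightarrow> real) set \<Rightarrow> 'a set \<Rightarrow> bool" where
  "adherent_zero \<K> B \<longleftrightarrow>
     (\<forall>F \<delta>. finite F \<and> F \<subseteq> \<K> \<and> 0 < \<delta> \<longrightarrow> (\<exists>a\<in>B. \<forall>k\<in>F. \<bar>k a\<bar> < \<delta>))"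

lemma adherent_zeroD:
  assumes "adherent_zero \<K> B" "finite F" "F \<subseteq> \<K>" "0 < \<delta>"
  obtains a where "a \<in> B" "\<forall>k\<in>F. \<bar>k a\<bar> < \<delta>"
proof -
  have "\<exists>a\<in>B. \<forall>k\<in>F. \<bar>k a\<bar> < \<delta>"
    using assms unfolding adherent_zero_def by simp
  then show thesis
    using that by blast
qed

lemma not_adherent_zero_iff:
  "\<not> adherent_zero \<K> B \<longleftrightarrow>
     (\<exists>F \<delta>. finite F \<and> F \<subseteq> \<K> \<and> 0 < \<delta> \<and> (\<forall>a\<in>B. \<exists>k\<in>F. \<delta> \<le> \<bar>k a\<bar>))"
  by (simp add: adherent_zero_def not_less)

text \<open>Two finite sets of functionals that keep \<open>B1\<close> and \<open>B2\<close> away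
  from the origin unite to one that keeps \<open>B1 \<union> B2\<close> away. So adherence survives
  in a piece of every finite partition, the pigeonhole principle of the extraction.\<close>

lemma adherent_zero_Un:
  assumes "adherent_zero \<K> (B1 \<union> B2)"
  shows "adherent_zero \<K> B1 \<or> adherent_zero \<K> B2"
proof (rule ccontr)
  assume "\<not> ?thesis"
  then have no: "\<not> adherent_zero \<K> B1" "\<not> adherent_zero \<K> B2"
    by auto
  obtain F1 \<delta>1 where 1: "finite F1" "F1 \<subseteq> \<K>" "0 < \<delta>1" "\<forall>a\<in>B1. \<exists>k\<in>F1. \<delta>1 \<le> \<bar>k a\<bar>"
    using no(1) unfolding not_adherent_zero_iff by auto
  obtain F2 \<delta>2 where 2: "finite F2" "F2 \<subseteq> \<K>" "0 < \<delta>2" "\<forall>a\<in>B2. \<exists>k\<in>F2. \<delta>2 \<le> \<bar>k a\<bar>"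
    using no(2) unfolding not_adherent_zero_iff by auto
  have "finite (F1 \<union> F2)" "F1 \<union> F2 \<subseteq> \<K>" "0 < min \<delta>1 \<delta>2"
    using 1(1-3) 2(1-3) by auto
  then obtain a where a: "a \<in> B1 \<union> B2" "\<forall>k\<in>F1 \<union> F2. \<bar>k a\<bar> < min \<delta>1 \<delta>2"
    by (rule adherent_zeroD[OF assms])
  from a(1) show False
  proof
    assume "a \<in> B1"
    then obtain k where k: "k \<in> F1" "\<delta>1 \<le> \<bar>k a\<bar>"
      using 1(4) by auto
    with bspec[OF a(2), of k] show False
      by simp
  next
    assume "a \<in> B2"
    then obtain k where k: "k \<in> F2" "\<delta>2 \<le> \<bar>k a\<bar>"
      using 2(4) by auto
    with bspec[OF a(2), of k] show False
      by simp
  qed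
qed

lemma adherent_zero_mono: "adherent_zero \<K> B \<Longrightarrow> B \<subseteq> B' \<Longrightarrow> adherent_zero \<K> B'"
  unfolding adherent_zero_def by (meson subsetD)

lemma adherent_zero_antimono: "adherent_zero \<K> B \<Longrightarrow> \<K>' \<subseteq> \<K> \<Longrightarrow> adherent_zero \<K>' B"
  unfolding adherent_zero_def by (meson order_trans)

lemma adherent_zero_finite_UNION:
  assumes "finite I" "adherent_zero \<K> B" "B \<subseteq> (\<Union>i\<in>I. S i)"
  obtains i where "i \<in> I" "adherent_zero \<K> (S i)"
proof -
  have "adherent_zero \<K> (\<Union>i\<in>I. S i)"
    using assms(2,3) by (rule adherent_zero_mono)
  with assms(1) have "\<exists>i\<in>I. adherent_zero \<K> (S i)"
  proof (induction I)
    case empty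
    then show ?case
      using adherent_zeroD[of \<K> "{}" "{}" 1] by auto
  next
    case (insert i I)
    then show ?case
      using adherent_zero_Un[of \<K> "S i" "\<Union>i\<in>I. S i"] by auto
  qed
  then show thesis
    using that by blast
qed

lemma adherent_zero_restrict:
  assumes "adherent_zero \<K> B" "finite F" "F \<subseteq> \<K>" "0 < \<delta>"
  shows "adherent_zero \<K> {a \<in> B. \<forall>k\<in>F. \<bar>k a\<bar> < \<delta>}"
  unfolding adherent_zero_def
proof (intro allI impI)
  fix G \<eta> assume G: "finite G \<and> G \<subseteq> \<K> \<and> 0 < (\<eta>::real)"
  have "finite (F \<union> G)" "F \<union> G \<subseteq> \<K>" "0 < min \<delta> \<eta>"
    using assms(2-4) G by auto
  then obtain a where "a \<in> B" "\<forall>k\<in>F \<union> G. \<bar>k a\<bar> < min \<delta> \<eta>"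
    by (rule adherent_zeroD[OF assms(1)])
  then show "\<exists>a\<in>{a \<in> B. \<forall>k\<in>F. \<bar>k a\<bar> < \<delta>}. \<forall>k\<in>G. \<bar>k a\<bar> < \<eta>"
    by auto
qed

text \<open>The open sets \<open>U a\<close> of tuples that are small at \<open>a\<close> cover the
  compact power of \<open>K\<close>, and a finite subcover gives \<open>F\<close>. Tuples are
  infinite sequences of which only the first \<open>n\<close> entries are tested.\<close>

lemma finite_uniform_adherent_zero:
  fixes K :: "('a \<Rightarrow> real) set"
  assumes "compact K" "adherent_zero K B" "0 < \<delta>"
  obtains F where "finite F" "F \<subseteq> B"
    "\<forall>h. (\<forall>i. h i \<in> K) \<longrightarrow> (\<exists>a\<in>F. \<forall>i<n::nat. \<bar>h i a\<bar> < \<delta>)"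
proof -
  let ?H = "\<Pi>\<^sub>E i\<in>(UNIV::nat set). K"
  define U where "U = (\<lambda>a. \<Inter>i\<in>{..<n}. {h :: nat \<Rightarrow> 'a \<Rightarrow> real. \<bar>h i a\<bar> < \<delta>})"
  have "compact ?H"
    by (intro compact_PiE_UNIV assms)
  moreover have "open (U a)" for a
  proof -
    have "continuous_on UNIV (\<lambda>h :: nat \<Rightarrow> 'a \<Rightarrow> real. h i a)" for i
      by (rule continuous_on_product_then_coordinatewise[OF continuous_on_product_coordinates])
    then show ?thesis
      unfolding U_def by (intro open_INT ballI open_Collect_less continuous_intros) auto
  qed
  moreover have "?H \<subseteq> (\<Union>a\<in>B. U a)"
  proof
    fix h assume "h \<in> ?H"
    then have "finite (h ` {..<n})" "h ` {..<n} \<subseteq> K"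
      by (auto simp: PiE_iff)
    from this assms(3) obtain a where "a \<in> B" "\<forall>k\<in>h ` {..<n}. \<bar>k a\<bar> < \<delta>"
      by (rule adherent_zeroD[OF assms(2)])
    then show "h \<in> (\<Union>a\<in>B. U a)"
      by (auto simp: U_def)
  qed
  ultimately obtain F where F: "F \<subseteq> B" "finite F" "?H \<subseteq> (\<Union>a\<in>F. U a)"
    by (rule compactE_image)
  have "\<forall>h. (\<forall>i. h i \<in> K) \<longrightarrow> (\<exists>a\<in>F. \<forall>i<n. \<bar>h i a\<bar> < \<delta>)"
  proof (intro allI impI)
    fix h :: "nat \<Rightarrow> 'a \<Rightarrow> real" assume "\<forall>i. h i \<in> K"
    then have "h \<in> ?H"
      by (simp add: PiE_iff)
    with F(3) have "h \<in> (\<Union>a\<in>F. U a)"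
      by (rule subsetD)
    then show "\<exists>a\<in>F. \<forall>i<n. \<bar>h i a\<bar> < \<delta>"
      by (auto simp: U_def)
  qed
  with F(2,1) show thesis
    by (rule that)
qed

section \<open>Diagonal extraction along an increasing sequence of compact sets\<close>

locale compact_exhaustion =
  fixes K :: "nat \<Rightarrow> ('a \<Rightarrow> real) set"
  assumes compact_K: "\<And>n. compact (K n)"
    and mono_K: "\<And>m n. m \<le> n \<Longrightarrow> K m \<subseteq> K n"
    and nonempty_K: "\<And>n. K n \<noteq> {}"
begin

abbreviation adh :: "'a set \<Rightarrow> bool" where
  "adh \<equiv> adherent_zero (\<Union>n. K n)"

text \<open>
  Compactness of the powers of \<open>K n\<close> provides a finite part of \<open>B n\<close> that serves all \<open>n\<close>-tuples
  of functionals in \<open>K n\<close>; the union of these finite parts is the desired set.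
\<close>

lemma adherent_zero_pseudo_intersection:
  assumes "\<And>n. adh (B n)" "\<And>n. B (Suc n) \<subseteq> B n"
  obtains D where "D \<subseteq> B 0" "countable D" "adh D" "\<forall>n. finite (D - B n)"
proof -
  have adh: "adherent_zero (K n) (B n)" for n
    using assms(1)[of n] by (rule adherent_zero_antimono) blast
  define good where "good = (\<lambda>n F. finite F \<and> F \<subseteq> B n \<and>
      (\<forall>h. (\<forall>i. h i \<in> K n) \<longrightarrow> (\<exists>a\<in>F. \<forall>i<n. \<bar>h i a\<bar> < 1 / Suc n)))"
  have "\<exists>F. good n F" for n
  proof -
    obtain F where "finite F" "F \<subseteq> B n"
      "\<forall>h. (\<forall>i. h i \<in> K n) \<longrightarrow> (\<exists>a\<in>F. \<forall>i<n. \<bar>h i a\<bar> < 1 / Suc n)"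
      by (rule finite_uniform_adherent_zero[OF compact_K adh, where n = n and \<delta> = "1 / Suc n"]) simp
    then have "good n F"
      by (simp add: good_def)
    then show ?thesis ..
  qed
  then obtain F where "\<And>n. good n (F n)"
    by metis
  then have F: "\<And>n. finite (F n)" "\<And>n. F n \<subseteq> B n"
    "\<And>n h. \<forall>i. h i \<in> K n \<Longrightarrow> \<exists>a\<in>F n. \<forall>i<n. \<bar>h i a\<bar> < 1 / Suc n"
    by (simp_all add: good_def)
  have dec: "B n \<subseteq> B m" if "m \<le> n" for m n
    using lift_Suc_antimono_le[of B, OF assms(2) that] .
  let ?D = "\<Union>n. F n"
  show thesis
  proof
    show "?D \<subseteq> B 0"
      using F(2) dec[OF le0] by (intro UN_least order_trans[OF F(2)])
    show "countable ?D"
      using F(1) by (intro countable_UN) (auto intro: countable_finite)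
    have "finite (?D - B n)" for n
    proof (rule finite_subset)
      show "?D - B n \<subseteq> (\<Union>i<n. F i)"
      proof
        fix a assume a: "a \<in> ?D - B n"
        then obtain i where i: "a \<in> F i"
          by auto
        have "i < n"
        proof (rule ccontr)
          assume "\<not> i < n"
          then have "a \<in> B n"
            using i F(2)[of i] dec[of n i] by auto
          with a show False
            by simp
        qed
        with i show "a \<in> (\<Union>i<n. F i)"
          by auto
      qed
    qed (use F(1) in auto)
    then show "\<forall>n. finite (?D - B n)" ..
    show "adh ?D"
      unfolding adherent_zero_def
    proof (intro allI impI)
      fix G \<delta> assume G: "finite G \<and> G \<subseteq> (\<Union>n. K n) \<and> 0 < (\<delta>::real)"
      have "\<exists>n. k \<in> K n" if "k \<in> G" for k
        using G that by auto
      then obtain N where N: "\<And>k. k \<in> G \<Longrightarrow> k \<in> K (N k)"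
        by metis
      obtain p where p: "1 / Suc p < \<delta>"
        using G nat_approx_posE[of \<delta>] by metis
      \<comment> \<open>The three summands ensure \<open>1 / Suc n < \<delta>\<close>, tuples long
        enough to list \<open>G\<close>, and \<open>G \<subseteq> K n\<close>.\<close>
      define n where "n = p + card G + (\<Sum>k\<in>G. N k)"
      have "N k \<le> n" if "k \<in> G" for k
        using G that member_le_sum[of k G N] by (simp add: n_def trans_le_add2)
      then have GK: "G \<subseteq> K n"
        using N mono_K by (meson subsetD subsetI)
      obtain e where e: "G = e ` {i::nat. i < card G}"
      proof -
        obtain e :: "nat \<Rightarrow> 'a \<Rightarrow> real" and c where "G = e ` {i. i < c}" "inj_on e {i. i < c}"
          using G finite_imp_nat_seg_image_inj_on[of G] by blast
        then show thesis
          using card_image[of e "{i. i < c}"] by (intro that[of e]) simp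
      qed
      obtain k0 where "k0 \<in> K n"
        using nonempty_K by (metis ex_in_conv)
      \<comment> \<open>\<open>F n\<close> was chosen for infinite sequences in \<open>K n\<close>,
        so the list of \<open>G\<close> is padded with an arbitrary member.\<close>
      define h where "h = (\<lambda>i. if i < card G then e i else k0)"
      have "\<forall>i. h i \<in> K n"
      proof
        fix i
        show "h i \<in> K n"
        proof (cases "i < card G")
          case True
          then have "e i \<in> G"
            by (subst e) simp
          then show ?thesis
            using GK True by (auto simp: h_def)
        qed (use \<open>k0 \<in> K n\<close> in \<open>simp add: h_def\<close>)
      qed
      then have "\<exists>a\<in>F n. \<forall>i<n. \<bar>h i a\<bar> < 1 / Suc n"
        by (rule F(3))
      then obtain a where a: "a \<in> F n" "\<forall>i<n. \<bar>h i a\<bar> < 1 / Suc n" ..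
      have "p \<le> n"
        by (simp add: n_def)
      then have "1 / Suc n \<le> 1 / Suc p"
        by (intro divide_left_mono) auto
      have "\<bar>k a\<bar> < \<delta>" if "k \<in> G" for k
      proof -
        obtain i where "i < card G" "k = e i"
          using e \<open>k \<in> G\<close> by (metis (mono_tags) imageE mem_Collect_eq)
        moreover from this have "i < n"
          by (simp add: n_def)
        ultimately have "\<bar>k a\<bar> < 1 / Suc n"
          using a(2) by (auto simp: h_def)
        then show ?thesis
          using p \<open>1 / Suc n \<le> 1 / Suc p\<close> by linarith
      qed
      then show "\<exists>a\<in>?D. \<forall>k\<in>G. \<bar>k a\<bar> < \<delta>"
        using a(1) by (intro bexI[of _ a]) auto
    qed
  qed
qed

text \<open>Refining successively for \<open>P 0\<close>, \<open>P 1\<close>, ... gives a decreasing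
  sequence of adherent sets, and \<open>D\<close> is almost contained in each of them. For trivial
  \<open>P\<close> this extracts a countable adherent subset.\<close>

lemma adherent_zero_diagonal:
  assumes "adh A"
    and "\<And>n B. B \<subseteq> A \<Longrightarrow> adh B \<Longrightarrow> \<exists>B'\<subseteq>B. adh B' \<and> P n B'"
  obtains D where "D \<subseteq> A" "countable D" "adh D" "\<forall>n. \<exists>B'. finite (D - B') \<and> P (n::nat) B'"
proof -
  have "\<exists>B. \<forall>n. (B n \<subseteq> A \<and> adh (B n)) \<and> (B (Suc n) \<subseteq> B n \<and> P n (B (Suc n)))"
  proof (rule dependent_nat_choice)
    show "\<exists>B. B \<subseteq> A \<and> adh B"
      using assms(1) by auto
    show "\<exists>B'. (B' \<subseteq> A \<and> adh B') \<and> B' \<subseteq> B \<and> P n B'" if "B \<subseteq> A \<and> adh B" for B n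
      using assms(2)[of B n] that by (meson order_trans)
  qed
  then obtain B where B: "\<And>n. B n \<subseteq> A" "\<And>n. adh (B n)" "\<And>n. B (Suc n) \<subseteq> B n"
    "\<And>n. P n (B (Suc n))"
    by metis
  obtain D where D: "D \<subseteq> B 0" "countable D" "adh D" "\<forall>n. finite (D - B n)"
    by (rule adherent_zero_pseudo_intersection[where B = B, OF B(2,3)])
  show thesis
  proof (rule that[of D])
    show "D \<subseteq> A"
      using D(1) B(1) by (rule order_trans)
    show "\<forall>n. \<exists>B'. finite (D - B') \<and> P n B'"
      using B(4) D(4) by metis
  qed (fact D)+
qed

end

section \<open>Halving sets of functionals\<close>

text \<open>Rosenthal's independence of the pairs \<open>{k. \<epsilon> \<le> k (x i)}\<close>,
  \<open>{k. k (x i) \<le> \<epsilon> / 2}\<close> within \<open>K\<close>. The gap between the two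
  thresholds is what gives an \<open>\<ell>\<^sub>1\<close>-estimate.\<close>

definition independent_on :: "('a \<Rightarrow> real) set \<Rightarrow> real \<Rightarrow> (nat \<Rightarrow> 'a) \<Rightarrow> bool" where
  "independent_on K \<epsilon> x \<longleftrightarrow>
     (\<forall>n \<sigma>. \<exists>k\<in>K. \<forall>i<n. if \<sigma> i then \<epsilon> \<le> k (x i) else k (x i) \<le> \<epsilon> / 2)"

text \<open>One-sided, to match the halves, which need not be symmetric; negative values are treated
  at the end through the symmetry of \<open>K n\<close>.\<close>

definition null_on :: "real \<Rightarrow> ('a \<Rightarrow> real) set \<Rightarrow> 'a set \<Rightarrow> bool" where
  "null_on \<epsilon> L D \<longleftrightarrow> (\<forall>k\<in>L. finite {a\<in>D. \<epsilon> \<le> k a})"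

lemma null_on_almost_subset:
  assumes "null_on \<delta> L B" "finite (D - B)" "\<delta> \<le> \<epsilon>"
  shows "null_on \<epsilon> L D"
  unfolding null_on_def
proof
  fix k assume "k \<in> L"
  then have "finite ((D - B) \<union> {a\<in>B. \<delta> \<le> k a})"
    using assms(1,2) by (simp add: null_on_def)
  then show "finite {a\<in>D. \<epsilon> \<le> k a}"
    by (rule finite_subset[rotated]) (use assms(3) in auto)
qed

definition half :: "real \<Rightarrow> bool \<Rightarrow> 'a \<Rightarrow> ('a \<Rightarrow> real) set \<Rightarrow> ('a \<Rightarrow> real) set" where
  "half \<epsilon> t a L = {k \<in> L. if t then \<epsilon> \<le> k a else k a \<le> \<epsilon> / 2}"

definition halves :: "real \<Rightarrow> 'a \<Rightarrow> ('a \<Rightarrow> real) set set \<Rightarrow> ('a \<Rightarrow> real) set set" where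
  "halves \<epsilon> a \<L> = (\<Union>t. half \<epsilon> t a ` \<L>)"

lemma mem_halves_iff: "M \<in> halves \<epsilon> a \<L> \<longleftrightarrow> (\<exists>L\<in>\<L>. \<exists>t. M = half \<epsilon> t a L)"
  by (auto simp: halves_def)

text \<open>The split family is the smaller one, so well-foundedness says that splitting into
  nonempty halves by points of \<open>A\<close> must stop.\<close>

definition halving_rel ::
  "('a \<Rightarrow> real) set \<Rightarrow> real \<Rightarrow> 'a set \<Rightarrow> (('a \<Rightarrow> real) set set \<times> ('a \<Rightarrow> real) set set) set" where
  "halving_rel K \<epsilon> A =
     {(halves \<epsilon> a \<L>, \<L>) |a \<L>. a \<in> A \<and> \<L> \<noteq> {} \<and> \<Union>\<L> \<subseteq> K \<and> {} \<notin> halves \<epsilon> a \<L>}"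

text \<open>An infinite descent chooses points \<open>x i\<close>. For a fixed \<open>L\<close> in
  the first family, the functionals in \<open>L\<close> with a prescribed pattern on
  \<open>x 0\<close>, ..., \<open>x (n - 1)\<close> form a member of the \<open>n\<close>-th family.
  These members are nonempty, so \<open>x\<close> is independent.\<close>

lemma wf_halving_rel:
  assumes "\<And>x. range x \<subseteq> A \<Longrightarrow> \<not> independent_on K \<epsilon> x"
  shows "wf (halving_rel K \<epsilon> A)"
  unfolding wf_iff_no_infinite_down_chain
proof
  assume "\<exists>f. \<forall>i. (f (Suc i), f i) \<in> halving_rel K \<epsilon> A"
  then obtain f where f: "\<And>i. (f (Suc i), f i) \<in> halving_rel K \<epsilon> A"
    by metis
  have "\<exists>a. a \<in> A \<and> f (Suc i) = halves \<epsilon> a (f i) \<and> f i \<noteq> {} \<and> \<Union>(f i) \<subseteq> K \<and> {} \<notin> f (Suc i)"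
    for i
    using f[of i] by (auto simp: halving_rel_def)
  then obtain x where x: "\<And>i. x i \<in> A" "\<And>i. f (Suc i) = halves \<epsilon> (x i) (f i)"
    "\<And>i. f i \<noteq> {}" "\<And>i. \<Union>(f i) \<subseteq> K" "\<And>i. {} \<notin> f (Suc i)"
    by metis
  obtain L where L: "L \<in> f 0"
    using x(3) by blast
  have mem: "{k \<in> L. \<forall>i<n. if \<sigma> i then \<epsilon> \<le> k (x i) else k (x i) \<le> \<epsilon> / 2} \<in> f n" for n \<sigma>
  proof (induction n)
    case (Suc n)
    have "{k \<in> L. \<forall>i<Suc n. if \<sigma> i then \<epsilon> \<le> k (x i) else k (x i) \<le> \<epsilon> / 2} =
      half \<epsilon> (\<sigma> n) (x n) {k \<in> L. \<forall>i<n. if \<sigma> i then \<epsilon> \<le> k (x i) else k (x i) \<le> \<epsilon> / 2}"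
      by (auto simp: half_def All_less_Suc)
    also have "\<dots> \<in> f (Suc n)"
      unfolding x(2) halves_def using Suc by (intro UN_I[of "\<sigma> n"] imageI UNIV_I)
    finally show ?case .
  qed (simp add: L)
  have "independent_on K \<epsilon> x"
    unfolding independent_on_def
  proof (intro allI)
    fix n \<sigma>
    \<comment> \<open>Empty members are excluded only from \<open>f (Suc n)\<close>, so a pattern of
      length \<open>Suc n\<close> is realized and then truncated.\<close>
    obtain k where "k \<in> L" and k: "\<forall>i<Suc n. if \<sigma> i then \<epsilon> \<le> k (x i) else k (x i) \<le> \<epsilon> / 2"
    proof -
      have "{k \<in> L. \<forall>i<Suc n. if \<sigma> i then \<epsilon> \<le> k (x i) else k (x i) \<le> \<epsilon> / 2} \<noteq> {}"
        using mem[of "Suc n" \<sigma>] x(5)[of n] by metis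
      then show thesis
        unfolding ex_in_conv[symmetric] mem_Collect_eq by (elim exE conjE) (rule that)
    qed
    moreover have "k \<in> K"
      using \<open>k \<in> L\<close> L x(4)[of 0] by auto
    moreover have "if \<sigma> i then \<epsilon> \<le> k (x i) else k (x i) \<le> \<epsilon> / 2" if "i < n" for i
      using k less_SucI[OF that] by metis
    ultimately show "\<exists>k\<in>K. \<forall>i<n. if \<sigma> i then \<epsilon> \<le> k (x i) else k (x i) \<le> \<epsilon> / 2"
      by (intro bexI[of _ k] allI impI)
  qed
  moreover have "range x \<subseteq> A"
    using x(1) by blast
  ultimately show False
    using assms by blast
qed

context compact_exhaustion
begin

text \<open>
  For a sequence of points the extraction is made once for each point \<open>b n\<close>, and \<open>D\<close> is a
  diagonal set on which one choice \<open>(L, t)\<close> works for all its points. If \<open>t\<close> holds, every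
  \<open>k \<in> L\<close> that takes a value at least \<open>\<epsilon>\<close> on \<open>D\<close> lies in a half on which \<open>D\<close> is null;
  otherwise every \<open>k \<in> L\<close> does, because \<open>k\<close> takes small values on \<open>D\<close>.
\<close>

lemma halving_induct_step:
  assumes "0 < \<epsilon>" and A: "adh B"
    and \<L>: "finite \<L>" "\<L> \<noteq> {}" "{} \<notin> \<L>" "\<Union>\<L> \<subseteq> K n0"
    and IH: "\<And>a B'. a \<in> B \<Longrightarrow> {} \<notin> halves \<epsilon> a \<L> \<Longrightarrow> B' \<subseteq> B \<Longrightarrow> adh B' \<Longrightarrow>
      \<exists>D\<subseteq>B'. adh D \<and> (\<exists>L\<in>halves \<epsilon> a \<L>. null_on \<epsilon> L D)"
  shows "\<exists>D\<subseteq>B. adh D \<and> (\<exists>L\<in>\<L>. null_on \<epsilon> L D)"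
proof -
  obtain C where C: "C \<subseteq> B" "countable C" "adh C"
    using adherent_zero_diagonal[OF A, of "\<lambda>_ _. True"] by auto
  \<comment> \<open>At points of \<open>B1\<close> every half is nonempty and the induction
    hypothesis applies; at points of \<open>B2\<close> some half is empty.\<close>
  define B1 where "B1 = {a \<in> C. {} \<notin> halves \<epsilon> a \<L>}"
  define B2 where "B2 = {a \<in> C. {} \<in> halves \<epsilon> a \<L>}"
  have "C = B1 \<union> B2"
    by (auto simp: B1_def B2_def)
  then consider "adh B1" | "adh B2"
    using C(3) adherent_zero_Un by metis
  then show ?thesis
  proof cases
    case 1
    have "B1 \<noteq> {}"
      using adherent_zeroD[OF 1, of "{}" 1] by auto
    have "countable B1"
      using C(2) by (simp add: B1_def)
    define b where "b = from_nat_into B1"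
    have b: "range b = B1"
      using \<open>B1 \<noteq> {}\<close> \<open>countable B1\<close> by (simp add: b_def range_from_nat_into)
    have "\<exists>D\<subseteq>B'. adh D \<and> (\<exists>L\<in>halves \<epsilon> (b n) \<L>. null_on \<epsilon> L D)"
      if "B' \<subseteq> B1" "adh B'" for n B'
    proof -
      have "b n \<in> B1"
        using b by blast
      then show ?thesis
        using that C(1) by (intro IH) (auto simp: B1_def)
    qed
    then obtain D where D: "D \<subseteq> B1" "countable D" "adh D"
      and DP: "\<forall>n. \<exists>B'. finite (D - B') \<and> (\<exists>L\<in>halves \<epsilon> (b n) \<L>. null_on \<epsilon> L B')"
      by (rule adherent_zero_diagonal[where P = "\<lambda>n B'. \<exists>L\<in>halves \<epsilon> (b n) \<L>. null_on \<epsilon> L B'", OF 1])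
    define S where "S = (\<lambda>(L, t). {a \<in> D. null_on \<epsilon> (half \<epsilon> t a L) D})"
    have "D \<subseteq> (\<Union>p\<in>\<L> \<times> UNIV. S p)"
    proof
      fix a assume "a \<in> D"
      then obtain n where n: "a = b n"
        using D(1) b by auto
      obtain B' L where B': "finite (D - B')" and L: "L \<in> halves \<epsilon> a \<L>" "null_on \<epsilon> L B'"
        using spec[OF DP, of n] n by auto
      have "null_on \<epsilon> L D"
        using L(2) B' by (rule null_on_almost_subset) simp
      moreover obtain M t where "M \<in> \<L>" "L = half \<epsilon> t a M"
        using L(1) by (auto simp: halves_def)
      ultimately have "a \<in> S (M, t)"
        using \<open>a \<in> D\<close> by (simp add: S_def)
      then show "a \<in> (\<Union>p\<in>\<L> \<times> UNIV. S p)"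
        using \<open>M \<in> \<L>\<close> by (intro UN_I[of "(M, t)"]) auto
    qed
    moreover have "finite (\<L> \<times> (UNIV :: bool set))"
      using \<L>(1) by simp
    ultimately obtain p where "p \<in> \<L> \<times> UNIV" "adh (S p)"
      using adherent_zero_finite_UNION[OF _ D(3)] by metis
    then obtain L t where "L \<in> \<L>" and S: "adh (S (L, t))"
      by auto
    have sub: "S (L, t) \<subseteq> D"
      by (auto simp: S_def)
    have fin: "finite {a'\<in>S (L, t). \<epsilon> \<le> k a'}" if "a \<in> S (L, t)" "k \<in> half \<epsilon> t a L" for a k
    proof (rule finite_subset)
      show "{a'\<in>S (L, t). \<epsilon> \<le> k a'} \<subseteq> {a'\<in>D. \<epsilon> \<le> k a'}"
        using sub by auto
      show "finite {a'\<in>D. \<epsilon> \<le> k a'}"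
        using that by (auto simp: S_def null_on_def)
    qed
    have "null_on \<epsilon> L (S (L, t))"
      unfolding null_on_def
    proof
      fix k assume k: "k \<in> L"
      show "finite {a\<in>S (L, t). \<epsilon> \<le> k a}"
      proof (cases t)
        case True
        show ?thesis
        proof (cases "{a\<in>S (L, t). \<epsilon> \<le> k a} = {}")
          case False
          then obtain a where a: "a \<in> S (L, t)" "\<epsilon> \<le> k a"
            by auto
          then have "k \<in> half \<epsilon> t a L"
            using True k by (simp add: half_def)
          with a(1) show ?thesis
            by (rule fin)
        qed (metis finite.emptyI)
      next
        case False
        have "finite {k}" "{k} \<subseteq> (\<Union>n. K n)" "0 < \<epsilon> / 2"
          using k \<open>L \<in> \<L>\<close> \<L>(4) \<open>0 < \<epsilon>\<close> by auto
        then obtain a where a: "a \<in> S (L, t)" "\<forall>l\<in>{k}. \<bar>l a\<bar> < \<epsilon> / 2"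
          by (rule adherent_zeroD[OF S])
        then have "k \<in> half \<epsilon> t a L"
          using False k by (simp add: half_def)
        with a(1) show ?thesis
          by (rule fin)
      qed
    qed
    moreover have "S (L, t) \<subseteq> B"
      using sub D(1) C(1) by (auto simp: B1_def)
    ultimately show ?thesis
      using S \<open>L \<in> \<L>\<close> by metis
  next
    case 2
    \<comment> \<open>Restricting to points where one chosen \<open>\<kappa> L\<close> from each
      \<open>L\<close> is below \<open>\<epsilon> / 2\<close> in absolute value makes all lower
      halves nonempty. The empty half is then an upper one: no functional of that \<open>L\<close>
      reaches \<open>\<epsilon>\<close>.\<close>
    have "\<forall>L\<in>\<L>. \<exists>k. k \<in> L"
      using \<L>(3) by (metis ex_in_conv)
    then obtain \<kappa> where \<kappa>: "\<And>L. L \<in> \<L> \<Longrightarrow> \<kappa> L \<in> L"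
      by metis
    define B3 where "B3 = {a \<in> B2. \<forall>k\<in>\<kappa> ` \<L>. \<bar>k a\<bar> < \<epsilon> / 2}"
    have "adh B3"
      unfolding B3_def
    proof (rule adherent_zero_restrict[OF 2])
      show "\<kappa> ` \<L> \<subseteq> (\<Union>n. K n)"
        using \<kappa> \<L>(4) by auto
    qed (use \<L>(1) \<open>0 < \<epsilon>\<close> in auto)
    define S where "S = (\<lambda>L. {a \<in> B3. half \<epsilon> True a L = {}})"
    have "B3 \<subseteq> (\<Union>L\<in>\<L>. S L)"
    proof
      fix a assume a: "a \<in> B3"
      then have "{} \<in> halves \<epsilon> a \<L>"
        by (simp add: B3_def B2_def)
      then obtain L t where L: "L \<in> \<L>" "half \<epsilon> t a L = {}"
        unfolding mem_halves_iff by metis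
      have "\<bar>\<kappa> L a\<bar> < \<epsilon> / 2"
        using a L(1) by (simp add: B3_def)
      then have "\<kappa> L \<in> half \<epsilon> False a L"
        using \<kappa>[OF L(1)] by (simp add: half_def)
      with L(2) have t
        by (cases t) auto
      then show "a \<in> (\<Union>L\<in>\<L>. S L)"
        using a L by (auto simp: S_def)
    qed
    then obtain L where L: "L \<in> \<L>" "adh (S L)"
      using adherent_zero_finite_UNION[OF \<L>(1) \<open>adh B3\<close>] by metis
    have "null_on \<epsilon> L (S L)"
      unfolding null_on_def
    proof
      fix k assume "k \<in> L"
      then have "{a\<in>S L. \<epsilon> \<le> k a} = {}"
        by (auto simp: S_def half_def)
      then show "finite {a\<in>S L. \<epsilon> \<le> k a}"
        by (metis finite.emptyI)
    qed
    moreover have "S L \<subseteq> B"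
      using C(1) by (auto simp: S_def B3_def B2_def)
    ultimately show ?thesis
      using L by metis
  qed
qed

text \<open>Well-founded induction over finite families, applied to \<open>{K n}\<close>, where the
  member on which \<open>D\<close> is null can only be \<open>K n\<close>.\<close>

lemma adherent_zero_null_on:
  assumes "0 < \<epsilon>" "adh A" and no: "\<And>x. range x \<subseteq> A \<Longrightarrow> \<not> independent_on (K n) \<epsilon> x"
  shows "\<exists>D\<subseteq>A. adh D \<and> null_on \<epsilon> (K n) D"
proof -
  have wf: "wf (halving_rel (K n) \<epsilon> A)"
    by (rule wf_halving_rel) (rule no)
  have "finite \<L> \<Longrightarrow> \<L> \<noteq> {} \<Longrightarrow> {} \<notin> \<L> \<Longrightarrow> \<Union>\<L> \<subseteq> K n \<Longrightarrow> B \<subseteq> A \<Longrightarrow> adh B \<Longrightarrow>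
    \<exists>D\<subseteq>B. adh D \<and> (\<exists>L\<in>\<L>. null_on \<epsilon> L D)" for \<L> B
  proof (induction \<L> arbitrary: B rule: wf_induct_rule[OF wf])
    case (1 \<L>)
    show ?case
    proof (rule halving_induct_step[OF assms(1) 1(7) 1(2-5)])
      fix a B' assume a: "a \<in> B" "{} \<notin> halves \<epsilon> a \<L>" "B' \<subseteq> B" "adh B'"
      show "\<exists>D\<subseteq>B'. adh D \<and> (\<exists>L\<in>halves \<epsilon> a \<L>. null_on \<epsilon> L D)"
      proof (rule 1(1))
        have "a \<in> A"
          using a(1) 1(6) by auto
        then show "(halves \<epsilon> a \<L>, \<L>) \<in> halving_rel (K n) \<epsilon> A"
          unfolding halving_rel_def using a(2) 1(3,5) by auto
        show "\<Union>(halves \<epsilon> a \<L>) \<subseteq> K n"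
          using 1(5) by (auto simp: halves_def half_def)
        show "finite (halves \<epsilon> a \<L>)" "halves \<epsilon> a \<L> \<noteq> {}"
          using 1(2,3) by (auto simp: halves_def)
        show "B' \<subseteq> A"
          using a(3) 1(6) by auto
      qed (fact a)+
    qed
  qed
  from this[of "{K n}" A] show ?thesis
    using assms(2) nonempty_K[of n] by simp
qed

text \<open>On a diagonal set \<open>D\<close> every functional exceeds a given
  \<open>\<delta> > 0\<close> only finitely often, and by symmetry so does its absolute value. If
  \<open>D\<close> is infinite, an injective enumeration is therefore null. If \<open>D\<close> is
  finite, one of its points is annihilated by all functionals and the constant sequence
  serves.\<close>

theorem adherent_zero_sequence:
  assumes "adh A"
    and no: "\<And>x n \<epsilon>. range x \<subseteq> A \<Longrightarrow> 0 < \<epsilon> \<Longrightarrow> \<not> independent_on (K n) \<epsilon> x"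
    and sym: "\<And>n k. k \<in> K n \<Longrightarrow> (\<lambda>a. - k a) \<in> K n"
  obtains x where "range x \<subseteq> A" "\<forall>n. \<forall>k\<in>K n. (\<lambda>i. k (x i)) \<longlonglongrightarrow> 0"
proof -
  have "\<exists>B'\<subseteq>B. adh B' \<and> null_on (1 / real (Suc n)) (K n) B'" if "B \<subseteq> A" "adh B" for n B
  proof (rule adherent_zero_null_on[OF _ that(2)])
    show "\<not> independent_on (K n) (1 / real (Suc n)) x" if "range x \<subseteq> B" for x
      using that \<open>B \<subseteq> A\<close> by (intro no) auto
  qed simp
  then obtain D where D: "D \<subseteq> A" "countable D" "adh D"
    and DP: "\<forall>n. \<exists>B'. finite (D - B') \<and> null_on (1 / real (Suc n)) (K n) B'"
    by (rule adherent_zero_diagonal[where P = "\<lambda>n. null_on (1 / Suc n) (K n)", OF assms(1)])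
  have fin: "finite {a\<in>D. \<delta> \<le> k a}" if "k \<in> K n" "0 < \<delta>" for k n \<delta>
  proof -
    obtain p where p: "1 / real (Suc p) < \<delta>"
      using nat_approx_posE[OF \<open>0 < \<delta>\<close>] by auto
    \<comment> \<open>Large enough for both \<open>k \<in> K ?m\<close> and a threshold
      \<open>1 / Suc ?m\<close> below \<open>\<delta>\<close>.\<close>
    let ?m = "max n p"
    have "1 / real (Suc ?m) \<le> 1 / real (Suc p)"
      by (intro divide_left_mono) auto
    then have le: "1 / real (Suc ?m) \<le> \<delta>"
      using p by linarith
    have "k \<in> K ?m"
      using that(1) mono_K[of n ?m] by auto
    obtain B' where B': "finite (D - B')" "null_on (1 / real (Suc ?m)) (K ?m) B'"
      using spec[OF DP, of ?m] by auto
    have "null_on \<delta> (K ?m) D"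
      by (rule null_on_almost_subset[OF B'(2,1) le])
    then show ?thesis
      using \<open>k \<in> K ?m\<close> by (simp add: null_on_def)
  qed
  have abs_fin: "finite {a\<in>D. \<delta> \<le> \<bar>k a\<bar>}" if "k \<in> K n" "0 < \<delta>" for k n \<delta>
  proof -
    have "{a\<in>D. \<delta> \<le> \<bar>k a\<bar>} \<subseteq> {a\<in>D. \<delta> \<le> k a} \<union> {a\<in>D. \<delta> \<le> - k a}"
      by auto
    moreover have "finite ({a\<in>D. \<delta> \<le> k a} \<union> {a\<in>D. \<delta> \<le> - k a})"
      using fin[OF that] fin[OF sym[OF that(1)] that(2)] by simp
    ultimately show ?thesis
      by (rule finite_subset)
  qed
  show thesis
  proof (cases "finite D")
    case True
    have "D \<subseteq> (\<Union>a\<in>D. {a})"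
      by auto
    then obtain a where a: "a \<in> D" "adh {a}"
      by (rule adherent_zero_finite_UNION[OF True D(3)])
    have zero: "k a = 0" if "k \<in> K n" for k n
    proof (rule ccontr)
      assume "k a \<noteq> 0"
      then show False
        using adherent_zeroD[OF a(2), of "{k}" "\<bar>k a\<bar>"] \<open>k \<in> K n\<close> by auto
    qed
    show thesis
    proof (rule that[of "\<lambda>_. a"])
      have "(\<lambda>i. k a) \<longlonglongrightarrow> 0" if "k \<in> K n" for n k
        using zero[OF that] by simp
      then show "\<forall>n. \<forall>k\<in>K n. (\<lambda>i. k a) \<longlonglongrightarrow> 0"
        by (intro allI ballI)
    qed (use a(1) D(1) in auto)
  next
    case False
    then obtain x where x: "bij_betw x (UNIV :: nat set) D"
      using bij_betw_from_nat_into[OF D(2)] by metis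
    show thesis
    proof (rule that[of x])
      show "range x \<subseteq> A"
        using x D(1) by (simp add: bij_betw_def)
      have "(\<lambda>i. k (x i)) \<longlonglongrightarrow> 0" if k: "k \<in> K n" for n k
        unfolding tendsto_iff
      proof (intro allI impI)
        fix \<delta> :: real assume "0 < \<delta>"
        have "finite (x -` {a\<in>D. \<delta> \<le> \<bar>k a\<bar>})"
          using abs_fin[OF k \<open>0 < \<delta>\<close>] x by (intro finite_vimageI) (auto simp: bij_betw_def)
        moreover have "x -` {a\<in>D. \<delta> \<le> \<bar>k a\<bar>} = {i. \<not> dist (k (x i)) 0 < \<delta>}"
          using x by (auto simp: bij_betw_def not_less)
        ultimately show "\<forall>\<^sub>F i in sequentially. dist (k (x i)) 0 < \<delta>"
          by (simp add: eventually_cofinite flip: cofinite_eq_sequentially)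
      qed
      then show "\<forall>n. \<forall>k\<in>K n. (\<lambda>i. k (x i)) \<longlonglongrightarrow> 0"
        by (intro allI ballI)
    qed
  qed
qed

end

section \<open>Polars and \<open>\<ell>\<^sub>1\<close>-sequences\<close>

text \<open>All conditions are pointwise, so the polar is closed under pointwise limits; for open
  \<open>V\<close> containing 0, continuity of its members follows from the bound on
  \<open>V\<close>.\<close>

definition polar :: "'a::real_vector set \<Rightarrow> ('a \<Rightarrow> real) set" where
  "polar V = {\<phi>. linear \<phi> \<and> (\<forall>x\<in>V. \<bar>\<phi> x\<bar> \<le> 1)}"

lemma eventually_scaleR_diff_mem:
  fixes V :: "'a::topological_real_vector set"
  assumes "open V" "0 \<in> V"
  shows "\<forall>\<^sub>F y in nhds x. r *\<^sub>R (y - x) \<in> V"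
proof -
  have "((\<lambda>y. r *\<^sub>R (y - x)) \<longlongrightarrow> r *\<^sub>R (x - x)) (nhds x)"
    by (intro tendsto_scaleR_tvs tendsto_diff tendsto_const filterlim_ident)
  then show ?thesis
    using assms by (auto dest: topological_tendstoD)
qed

lemma absorbing_open_zero:
  fixes V :: "'a::topological_real_vector set"
  assumes "open V" "0 \<in> V"
  obtains t :: real where "0 < t" "(1 / t) *\<^sub>R x \<in> V"
proof -
  have "((\<lambda>n. (1 / real (Suc n)) *\<^sub>R x) \<longlongrightarrow> 0 *\<^sub>R x) sequentially"
    by (intro tendsto_scaleR_tvs tendsto_const LIMSEQ_Suc[OF lim_1_over_n])
  then have "\<forall>\<^sub>F n in sequentially. (1 / real (Suc n)) *\<^sub>R x \<in> V"
    using assms by (auto dest: topological_tendstoD)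
  then obtain n where "(1 / real (Suc n)) *\<^sub>R x \<in> V"
    by (auto simp: eventually_sequentially)
  then show thesis
    by (intro that[of "real (Suc n)"]) auto
qed

lemma polar_le:
  assumes "\<phi> \<in> polar V" "r *\<^sub>R x \<in> V" "0 < r"
  shows "\<bar>\<phi> x\<bar> \<le> 1 / r"
proof -
  have "\<bar>r * \<phi> x\<bar> \<le> 1"
    using assms by (auto simp: polar_def linear_scale)
  then show ?thesis
    using assms(3) by (simp add: abs_mult pos_le_divide_eq mult.commute)
qed

text \<open>The Banach-Alaoglu theorem: \<open>V\<close> absorbs every \<open>x\<close>, which
  confines \<open>\<phi> x\<close> to an interval independent of \<open>\<phi>\<close>, and the
  polar is closed in the product of these intervals.\<close>

lemma compact_polar:
  fixes V :: "'a::topological_real_vector set"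
  assumes "open V" "0 \<in> V"
  shows "compact (polar V)"
proof -
  have "\<exists>t>0. (1 / t) *\<^sub>R x \<in> V" for x
    using absorbing_open_zero[OF assms, of x] by metis
  then obtain t where t: "\<And>x. 0 < t x" "\<And>x. (1 / t x) *\<^sub>R x \<in> V"
    by metis
  let ?P = "\<Pi>\<^sub>E x\<in>UNIV. {- t x..t x}"
  have sub: "polar V \<subseteq> ?P"
  proof
    fix \<phi> assume "\<phi> \<in> polar V"
    then have "\<bar>\<phi> x\<bar> \<le> t x" for x
      using polar_le[of \<phi> V "1 / t x" x] t by simp
    then show "\<phi> \<in> ?P"
      by (simp add: PiE_iff abs_le_iff minus_le_iff)
  qed
  have "closed {\<phi> :: 'a \<Rightarrow> real. (\<forall>x y. \<phi> (x + y) = \<phi> x + \<phi> y) \<and>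
      (\<forall>c x. \<phi> (c *\<^sub>R x) = c * \<phi> x) \<and> (\<forall>x. x \<in> V \<longrightarrow> \<bar>\<phi> x\<bar> \<le> 1)}"
    by (intro closed_Collect_conj closed_Collect_all closed_Collect_imp closed_Collect_eq
        closed_Collect_le open_Collect_const continuous_intros continuous_on_product_coordinates)
  then have "closed (polar V)"
    by (simp add: polar_def linear_iff Ball_def)
  moreover have "compact ?P"
    by (intro compact_PiE_UNIV compact_Icc)
  ultimately have "compact (?P \<inter> polar V)"
    by (intro compact_Int_closed)
  then show ?thesis
    using sub by (simp add: Int_absorb1)
qed

lemma polar_subset_topological_dual:
  fixes V :: "'a::topological_real_vector set"
  assumes "open V" "0 \<in> V"
  shows "polar V \<subseteq> topological_dual"
proof
  fix \<phi> assume \<phi>: "\<phi> \<in> polar V"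
  then have lin: "linear \<phi>"
    by (simp add: polar_def)
  have "(\<phi> \<longlongrightarrow> \<phi> x) (nhds x)" for x
    unfolding tendsto_iff
  proof (intro allI impI)
    fix e :: real assume "0 < e"
    show "\<forall>\<^sub>F y in nhds x. dist (\<phi> y) (\<phi> x) < e"
    proof (rule eventually_mono[OF eventually_scaleR_diff_mem[OF assms, of "2 / e" x]])
      fix y assume "(2 / e) *\<^sub>R (y - x) \<in> V"
      then have "\<bar>\<phi> (y - x)\<bar> \<le> e / 2"
        using polar_le[OF \<phi>, of "2 / e"] \<open>0 < e\<close> by simp
      then show "dist (\<phi> y) (\<phi> x) < e"
        using \<open>0 < e\<close> by (simp add: dist_real_def linear_diff[OF lin])
    qed
  qed
  then have "continuous_on UNIV \<phi>"
    unfolding continuous_on_def by (auto intro: tendsto_mono[OF at_within_le_nhds])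
  with lin show "\<phi> \<in> topological_dual"
    by (simp add: topological_dual_def)
qed

text \<open>Allowing every \<open>V \<subseteq> U\<close> makes the lemma applicable to a member of
  a given base; the polars of a base thus exhaust the dual.\<close>

lemma topological_dual_mem_polar:
  assumes "\<phi> \<in> topological_dual"
  obtains U where "open U" "0 \<in> U" "\<And>V. V \<subseteq> U \<Longrightarrow> \<phi> \<in> polar V"
proof -
  have lin: "linear \<phi>" and cont: "continuous_on UNIV \<phi>"
    using assms by (auto simp: topological_dual_def)
  show thesis
  proof (rule that[of "{x. \<bar>\<phi> x\<bar> < 1}"])
    show "open {x. \<bar>\<phi> x\<bar> < 1}"
      using cont by (intro open_Collect_less continuous_intros) auto
    show "\<phi> \<in> polar V" if "V \<subseteq> {x. \<bar>\<phi> x\<bar> < 1}" for V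
      using lin subsetD[OF that] by (fastforce simp: polar_def)
  qed (simp add: linear_0[OF lin])
qed

lemma metrizable_decreasing_base_zero:
  assumes "metrizable_space (euclidean :: 'a::topological_real_vector topology)"
  obtains V :: "nat \<Rightarrow> 'a::topological_real_vector set"
  where "\<And>n. open (V n)" "\<And>n. 0 \<in> V n" "\<And>m n. m \<le> n \<Longrightarrow> V n \<subseteq> V m"
    "\<And>U. open U \<Longrightarrow> 0 \<in> U \<Longrightarrow> \<exists>n. V n \<subseteq> U"
proof -
  obtain \<B> :: "'a set set" where \<B>: "countable \<B>" "\<forall>V\<in>\<B>. open V"
    "\<forall>U. open U \<and> 0 \<in> U \<longrightarrow> (\<exists>V\<in>\<B>. 0 \<in> V \<and> V \<subseteq> U)"
    using metrizable_imp_first_countable[OF assms]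
    unfolding first_countable_def open_openin[symmetric] topspace_euclidean by (metis UNIV_I)
  let ?B = "{V \<in> \<B>. 0 \<in> V}"
  define W where "W = from_nat_into ?B"
  have "?B \<noteq> {}"
    using \<B>(3) open_UNIV by blast
  moreover have "countable ?B"
    using \<B>(1) by simp
  ultimately have W: "range W = ?B"
    unfolding W_def by (rule range_from_nat_into)
  show thesis
  proof (rule that[of "\<lambda>n. \<Inter>i\<le>n. W i"])
    have "W i \<in> ?B" for i
      using W by blast
    then show "open (\<Inter>i\<le>n. W i)" "0 \<in> (\<Inter>i\<le>n. W i)" for n
      using \<B>(2) by auto
    show "(\<Inter>i\<le>n. W i) \<subseteq> (\<Inter>i\<le>m. W i)" if "m \<le> n" for m n
      using that by (intro INT_anti_mono) auto
    show "\<exists>n. (\<Inter>i\<le>n. W i) \<subseteq> U" if "open U" "0 \<in> U" for U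
    proof -
      obtain B where "B \<in> ?B" "B \<subseteq> U"
        using \<B>(3) \<open>open U\<close> \<open>0 \<in> U\<close> by blast
      then obtain n where "W n \<subseteq> U"
        using W by (metis imageE)
      then show ?thesis
        by (intro exI[of _ n]) auto
    qed
  qed
qed

section \<open>Bounded sequences and the maps \<open>ell1_map\<close>\<close>

lemma tvs_bounded_subset: "tvs_bounded C \<Longrightarrow> D \<subseteq> C \<Longrightarrow> tvs_bounded D"
  unfolding tvs_bounded_def by (meson order_trans)

text \<open>It bounds the sequences of points \<open>x - f x\<close>, as continuity of
  \<open>ell1_map\<close> requires.\<close>

lemma tvs_bounded_differences:
  fixes C :: "'a::topological_real_vector set"
  assumes "tvs_bounded C"
  shows "tvs_bounded {x - y |x y. x \<in> C \<and> y \<in> C}"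
  unfolding tvs_bounded_def
proof (intro allI impI)
  fix U :: "'a set" assume U: "open U \<and> 0 \<in> U"
  have "((\<lambda>p. fst p - snd p) \<longlongrightarrow> (0::'a) - 0) (nhds 0 \<times>\<^sub>F nhds 0)"
    by (intro tendsto_diff filterlim_fst filterlim_snd)
  then have "\<forall>\<^sub>F p in nhds (0::'a) \<times>\<^sub>F nhds 0. fst p - snd p \<in> U"
    using U by (auto dest: topological_tendstoD)
  then obtain P Q where ev: "eventually P (nhds (0::'a))" "eventually Q (nhds (0::'a))"
    and PQ: "\<And>a b. P a \<Longrightarrow> Q b \<Longrightarrow> a - b \<in> U"
    by (auto simp: eventually_prod_filter)
  from ev have "\<forall>\<^sub>F a in nhds (0::'a). P a \<and> Q a"
    by (rule eventually_conj)
  then obtain W where W: "open W" "0 \<in> W" "\<And>a. a \<in> W \<Longrightarrow> P a \<and> Q a"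
    unfolding eventually_nhds by metis
  obtain s where s: "s > 0" "\<forall>t>s. C \<subseteq> (\<lambda>x. t *\<^sub>R x) ` W"
    using assms W(1,2) unfolding tvs_bounded_def by metis
  have "{x - y |x y. x \<in> C \<and> y \<in> C} \<subseteq> (\<lambda>x. t *\<^sub>R x) ` U" if "t > s" for t
  proof clarify
    fix x y assume "x \<in> C" "y \<in> C"
    then obtain a b where "a \<in> W" "b \<in> W" "x = t *\<^sub>R a" "y = t *\<^sub>R b"
      using s(2) \<open>t > s\<close> by (meson imageE subsetD)
    then show "x - y \<in> (\<lambda>x. t *\<^sub>R x) ` U"
      using PQ[of a b] W(3) by (intro image_eqI[of _ _ "a - b"]) (auto simp: scaleR_diff_right)
  qed
  then show "\<exists>s>0. \<forall>t>s. {x - y |x y. x \<in> C \<and> y \<in> C} \<subseteq> (\<lambda>x. t *\<^sub>R x) ` U"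
    using s(1) by auto
qed

text \<open>The missing weight is placed on the origin.\<close>

lemma convex_subsum:
  fixes z :: "'i \<Rightarrow> 'a::real_vector"
  assumes "convex S" "0 \<in> S" "finite I"
    and "\<And>i. i \<in> I \<Longrightarrow> 0 \<le> c i" "sum c I \<le> 1" "\<And>i. i \<in> I \<Longrightarrow> z i \<in> S"
  shows "(\<Sum>i\<in>I. c i *\<^sub>R z i) \<in> S"
proof (cases "sum c I = 0")
  case True
  then have "\<forall>i\<in>I. c i = 0"
    using assms(3,4) by (simp add: sum_nonneg_eq_0_iff)
  then show ?thesis
    using assms(2) by simp
next
  case False
  let ?s = "sum c I"
  have "0 < ?s"
    using False sum_nonneg[of I c] assms(4) by fastforce
  have "(\<Sum>i\<in>I. (c i / ?s) *\<^sub>R z i) \<in> S"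
    using assms \<open>0 < ?s\<close> by (intro convex_sum) (auto simp flip: sum_divide_distrib)
  then have "?s *\<^sub>R (\<Sum>i\<in>I. (c i / ?s) *\<^sub>R z i) + (1 - ?s) *\<^sub>R 0 \<in> S"
    using assms \<open>0 < ?s\<close> by (intro convexD) auto
  then show ?thesis
    using False by (simp add: scaleR_sum_right)
qed

lemma norm_poly_mapping_superset:
  fixes c :: "'i \<Rightarrow>\<^sub>0 real"
  assumes "finite I" "Poly_Mapping.keys c \<subseteq> I"
  shows "norm c = (\<Sum>i\<in>I. \<bar>Poly_Mapping.lookup c i\<bar>)"
proof -
  have "norm c = (\<Sum>i\<in>Poly_Mapping.keys c. \<bar>Poly_Mapping.lookup c i\<bar>)"
    by (simp add: norm_poly_mapping_def dist_poly_mapping_def)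
  also have "\<dots> = (\<Sum>i\<in>I. \<bar>Poly_Mapping.lookup c i\<bar>)"
    using assms by (intro sum.mono_neutral_left) (auto simp: in_keys_iff)
  finally show ?thesis .
qed

text \<open>By linearity only small \<open>d\<close> matter. Boundedness gives
  \<open>x i = t *\<^sub>R y i\<close> with \<open>y i\<close> and \<open>- y i\<close> in a convex
  set \<open>v\<close>, so for \<open>norm d < 1 / t\<close> the image of \<open>d\<close> is a
  combination of points of \<open>v\<close> with nonnegative coefficients of sum at most 1.\<close>

lemma continuous_ell1_map:
  fixes x :: "nat \<Rightarrow> 'a::topological_real_vector"
  assumes "locally convex (UNIV :: 'a set)" "tvs_bounded (range x)"
  shows "continuous_on UNIV (ell1_map x)"
  unfolding continuous_on_def
proof
  fix c0 :: "nat \<Rightarrow>\<^sub>0 real"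
  let ?T = "ell1_map x"
  show "(?T \<longlongrightarrow> ?T c0) (at c0)"
  proof (rule topological_tendstoI)
    fix U assume U: "open U" "?T c0 \<in> U"
    have "continuous_on UNIV (\<lambda>z. ?T c0 + z)"
      by (intro continuous_intros)
    then have "open ((\<lambda>z. ?T c0 + z) -` U)"
      using U(1) by (rule open_vimage[rotated])
    moreover have "0 \<in> (\<lambda>z. ?T c0 + z) -` U"
      using U(2) by simp
    ultimately obtain u v where uv: "open u" "convex v" "0 \<in> u" "u \<subseteq> v"
      "v \<subseteq> (\<lambda>z. ?T c0 + z) -` U"
      using assms(1) unfolding locally_def by (metis open_openin subtopology_UNIV)
    \<comment> \<open>The neighbourhood is made symmetric so that the signs of the coefficients can
      be absorbed into the points.\<close>
    have "continuous_on UNIV (\<lambda>z::'a. - z)"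
      by (intro continuous_intros)
    then have "open (u \<inter> uminus -` u)"
      using uv(1) open_vimage[OF uv(1)] by (intro open_Int) auto
    moreover have "0 \<in> u \<inter> uminus -` u"
      using uv(3) by simp
    ultimately obtain s where s: "s > 0" "\<forall>t>s. range x \<subseteq> (\<lambda>x. t *\<^sub>R x) ` (u \<inter> uminus -` u)"
      using assms(2) unfolding tvs_bounded_def by metis
    define t where "t = s + 1"
    have "0 < t" "range x \<subseteq> (\<lambda>x. t *\<^sub>R x) ` (u \<inter> uminus -` u)"
      using s by (auto simp: t_def)
    then have "\<forall>i. \<exists>y. y \<in> u \<and> - y \<in> u \<and> x i = t *\<^sub>R y"
      by auto
    then obtain y where y: "\<And>i. y i \<in> u" "\<And>i. - y i \<in> u" "\<And>i. x i = t *\<^sub>R y i"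
      by metis
    have small: "?T d \<in> v" if d: "norm d < 1 / t" for d
    proof -
      let ?l = "Poly_Mapping.lookup d" and ?I = "Poly_Mapping.keys d"
      have "?T d = (\<Sum>i\<in>?I. (t * \<bar>?l i\<bar>) *\<^sub>R (if 0 \<le> ?l i then y i else - y i))"
        unfolding ell1_map_def by (intro sum.cong) (auto simp: y(3))
      also have "\<dots> \<in> v"
      proof (rule convex_subsum[OF uv(2)])
        have "(\<Sum>i\<in>?I. t * \<bar>?l i\<bar>) = t * norm d"
          by (simp add: norm_poly_mapping_superset[OF finite_keys order_refl] sum_distrib_left)
        then show "(\<Sum>i\<in>?I. t * \<bar>?l i\<bar>) \<le> 1"
          using d \<open>0 < t\<close> by (simp add: pos_less_divide_eq mult.commute)
      qed (use uv(3,4) y(1,2) \<open>0 < t\<close> in auto)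
      finally show ?thesis .
    qed
    have "?T c \<in> U" if "dist c c0 < 1 / t" for c
    proof -
      have "?T (c - c0) \<in> v"
        using that by (intro small) (simp add: dist_norm)
      moreover have "?T c = ?T c0 + ?T (c - c0)"
        by (simp add: linear_diff[OF linear_ell1_map])
      ultimately show ?thesis
        using uv(5) by auto
    qed
    then show "\<forall>\<^sub>F c in at c0. ?T c \<in> U"
      unfolding eventually_at using \<open>0 < t\<close> by (intro exI[of _ "1 / t"]) auto
  qed
qed

text \<open>
  Comparing functionals that realize the sign pattern of the coefficients and the opposite pattern
  gives the lower \<open>\<ell>\<^sub>1\<close>-estimate.
\<close>

lemma independent_on_ell1_lower_bound:
  assumes "independent_on K \<epsilon> x" "0 < \<epsilon>" and lin: "\<And>k. k \<in> K \<Longrightarrow> linear k"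
  obtains k where "k \<in> K" "\<epsilon> / 4 * norm c \<le> \<bar>k (ell1_map x c)\<bar>"
proof -
  let ?l = "Poly_Mapping.lookup c"
  obtain n where n: "Poly_Mapping.keys c \<subseteq> {..<n}"
    using finite_nat_iff_bounded finite_keys by metis
  have T: "ell1_map x c = (\<Sum>i<n. ?l i *\<^sub>R x i)"
    by (rule ell1_map_superset[OF _ n]) simp
  obtain k where k: "k \<in> K" "\<forall>i<n. if 0 \<le> ?l i then \<epsilon> \<le> k (x i) else k (x i) \<le> \<epsilon> / 2"
    using assms(1)[unfolded independent_on_def, rule_format, of n "\<lambda>i. 0 \<le> ?l i"] by auto
  obtain k' where k': "k' \<in> K" "\<forall>i<n. if \<not> 0 \<le> ?l i then \<epsilon> \<le> k' (x i) else k' (x i) \<le> \<epsilon> / 2"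
    using assms(1)[unfolded independent_on_def, rule_format, of n "\<lambda>i. \<not> 0 \<le> ?l i"] by auto
  have eval: "h (ell1_map x c) = (\<Sum>i<n. ?l i * h (x i))" if "h \<in> K" for h
    using lin[OF that] by (simp add: T linear_sum linear_scale)
  have "\<epsilon> / 2 * norm c = (\<Sum>i<n. \<epsilon> / 2 * \<bar>?l i\<bar>)"
    by (simp add: norm_poly_mapping_superset[OF _ n] sum_distrib_left)
  also have "\<dots> \<le> (\<Sum>i<n. ?l i * (k (x i) - k' (x i)))"
  proof (rule sum_mono)
    fix i assume i: "i \<in> {..<n}"
    show "\<epsilon> / 2 * \<bar>?l i\<bar> \<le> ?l i * (k (x i) - k' (x i))"
    proof (cases "0 \<le> ?l i")
      case True
      have "\<epsilon> \<le> k (x i)" "k' (x i) \<le> \<epsilon> / 2"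
        using spec[OF k(2), of i] spec[OF k'(2), of i] True i by auto
      then have "\<epsilon> / 2 \<le> k (x i) - k' (x i)"
        by linarith
      from mult_left_mono[OF this True] show ?thesis
        using True by (simp add: mult.commute)
    next
      case False
      have "\<epsilon> \<le> k' (x i)" "k (x i) \<le> \<epsilon> / 2"
        using spec[OF k(2), of i] spec[OF k'(2), of i] False i by auto
      then have "\<epsilon> / 2 \<le> k' (x i) - k (x i)"
        by linarith
      moreover have "0 \<le> - ?l i"
        using False by simp
      ultimately have "- ?l i * (\<epsilon> / 2) \<le> - ?l i * (k' (x i) - k (x i))"
        by (rule mult_left_mono)
      then show ?thesis
        using False by (simp add: algebra_simps)
    qed
  qed
  also have "\<dots> = k (ell1_map x c) - k' (ell1_map x c)"
    by (simp add: eval[OF k(1)] eval[OF k'(1)] right_diff_distrib sum_subtractf)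
  finally have "\<epsilon> / 4 * norm c \<le> \<bar>k (ell1_map x c)\<bar> \<or> \<epsilon> / 4 * norm c \<le> \<bar>k' (ell1_map x c)\<bar>"
    by linarith
  then show thesis
    using that k(1) k'(1) by metis
qed

text \<open>The lower estimate yields injectivity. It also yields continuity of the inverse, because
  functionals in the polar are small on small multiples of \<open>V\<close>.\<close>

lemma independent_on_polar_ell1_sequence:
  fixes x :: "nat \<Rightarrow> 'a::topological_real_vector"
  assumes "locally convex (UNIV :: 'a set)" "tvs_bounded (range x)"
    and V: "open V" "0 \<in> V" and ind: "independent_on (polar V) \<epsilon> x" "0 < \<epsilon>"
  shows "ell1_sequence x"
proof -
  let ?T = "ell1_map x"
  have lin: "linear k" if "k \<in> polar V" for k
    using that by (simp add: polar_def)
  have "c = 0" if "?T c = 0" for c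
  proof -
    obtain k where k: "k \<in> polar V" "\<epsilon> / 4 * norm c \<le> \<bar>k (?T c)\<bar>"
      by (rule independent_on_ell1_lower_bound[OF ind lin])
    then have "\<epsilon> / 4 * norm c \<le> 0"
      using that linear_0[OF lin[OF k(1)]] by simp
    then show ?thesis
      using ind(2) by (simp add: mult_le_0_iff)
  qed
  then have inj: "inj ?T"
    using linear_injective_0[OF linear_ell1_map] by metis
  have cont_inv: "continuous_on (range ?T) (inv ?T)"
    unfolding continuous_on_def
  proof clarify
    fix c0
    show "(inv ?T \<longlongrightarrow> inv ?T (?T c0)) (at (?T c0) within range ?T)"
      unfolding tendsto_iff eventually_at_filter
    proof (intro allI impI)
      fix e :: real assume "0 < e"
      \<comment> \<open>A functional in the polar is then at most
        \<open>1 / r = \<epsilon> * e / 8\<close> in absolute value on the difference, and the lower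
        bound \<open>\<epsilon> / 4 * norm (c - c0)\<close> forces
        \<open>norm (c - c0) \<le> e / 2\<close>.\<close>
      define r where "r = 8 / (\<epsilon> * e)"
      have "0 < r"
        using \<open>0 < e\<close> ind(2) by (simp add: r_def)
      show "\<forall>\<^sub>F y in nhds (?T c0). y \<noteq> ?T c0 \<longrightarrow> y \<in> range ?T \<longrightarrow> dist (inv ?T y) (inv ?T (?T c0)) < e"
      proof (rule eventually_mono[OF eventually_scaleR_diff_mem[OF V, of r "?T c0"]], intro impI)
        fix y assume y: "r *\<^sub>R (y - ?T c0) \<in> V" "y \<in> range ?T"
        then obtain c where c: "y = ?T c"
          by auto
        obtain k where k: "k \<in> polar V" "\<epsilon> / 4 * norm (c - c0) \<le> \<bar>k (?T (c - c0))\<bar>"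
          by (rule independent_on_ell1_lower_bound[OF ind lin])
        have "\<bar>k (?T (c - c0))\<bar> \<le> 1 / r"
          using y(1) \<open>0 < r\<close> by (intro polar_le[OF k(1)]) (simp_all add: c linear_diff[OF linear_ell1_map])
        with k(2) have "\<epsilon> / 4 * norm (c - c0) \<le> \<epsilon> * e / 8"
          by (simp add: r_def)
        then have "\<epsilon> * norm (c - c0) \<le> \<epsilon> * (e / 2)"
          by simp
        then have "norm (c - c0) \<le> e / 2"
          using ind(2) by (simp only: mult_le_cancel_left_pos)
        then show "dist (inv ?T y) (inv ?T (?T c0)) < e"
          using \<open>0 < e\<close> by (simp add: c inv_f_f[OF inj] dist_norm)
      qed
    qed
  qed
  have "homeomorphism UNIV (range ?T) ?T (inv ?T)"
    using continuous_ell1_map[OF assms(1,2)] cont_inv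
    by (intro homeomorphismI) (auto simp: inv_f_f[OF inj])
  then show ?thesis
    unfolding ell1_sequence_def using linear_ell1_map by blast
qed

section \<open>Conclusion: weakly null differences \<open>x n - f (x n)\<close>\<close>

theorem corollary3p4:
  assumes "metrizable_space (euclidean :: 'a::{topological_real_vector, t2_space} topology)"
    and "locally convex (UNIV :: 'a set)"
    and "\<not> (\<exists>x :: nat \<Rightarrow> 'a. ell1_sequence x)"
  shows "weak_AFPP TYPE('a)"
  unfolding weak_AFPP_def weak_AFPP_set_def
proof (intro allI impI)
  fix C :: "'a set" and f :: "'a \<Rightarrow> 'a"
  assume C: "C \<noteq> {} \<and> tvs_bounded C \<and> closed C \<and> convex C"
    and f: "continuous_on C f \<and> f ` C \<subseteq> C"
  obtain V :: "nat \<Rightarrow> 'a set" where V: "\<And>n. open (V n)" "\<And>n. 0 \<in> V n"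
    "\<And>m n. m \<le> n \<Longrightarrow> V n \<subseteq> V m" "\<And>U. open U \<Longrightarrow> 0 \<in> U \<Longrightarrow> \<exists>n. V n \<subseteq> U"
    using metrizable_decreasing_base_zero[OF assms(1)] by metis
  \<comment> \<open>Polarity reverses inclusions, so a decreasing base at the origin gives
    increasing polars.\<close>
  interpret compact_exhaustion "\<lambda>n. polar (V n)"
  proof
    show "compact (polar (V n))" for n
      by (rule compact_polar[OF V(1,2)])
    show "polar (V m) \<subseteq> polar (V n)" if "m \<le> n" for m n
      using V(3)[OF that] by (auto simp: polar_def)
    have "(\<lambda>_. 0) \<in> polar (V n)" for n
      by (simp add: polar_def linear_iff)
    then show "polar (V n) \<noteq> {}" for n
      by (metis empty_iff)
  qed
  define A where "A = (\<lambda>x. x - f x) ` C"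
  have "adh A"
    unfolding adherent_zero_def
  proof (intro allI impI)
    fix F \<delta> assume F: "finite F \<and> F \<subseteq> (\<Union>n. polar (V n)) \<and> 0 < (\<delta>::real)"
    have "(\<Union>n. polar (V n)) \<subseteq> topological_dual"
      by (intro UN_least polar_subset_topological_dual V)
    with F have "F \<subseteq> topological_dual"
      by (meson order_trans)
    then have "\<exists>x\<in>C. \<forall>\<phi>\<in>F. \<bar>\<phi> (x - f x)\<bar> < \<delta>"
      using C f F by (intro approximate_fixed_point) auto
    then show "\<exists>a\<in>A. \<forall>k\<in>F. \<bar>k a\<bar> < \<delta>"
      by (simp add: A_def)
  qed
  moreover have "\<not> independent_on (polar (V n)) \<epsilon> x" if x: "range x \<subseteq> A" "0 < \<epsilon>" for x n \<epsilon>
  proof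
    assume ind: "independent_on (polar (V n)) \<epsilon> x"
    have "A \<subseteq> {x - y |x y. x \<in> C \<and> y \<in> C}"
      using f by (auto simp: A_def)
    with x(1) have "range x \<subseteq> {x - y |x y. x \<in> C \<and> y \<in> C}"
      by (rule order_trans)
    moreover have "tvs_bounded {x - y |x y. x \<in> C \<and> y \<in> C}"
      using C by (intro tvs_bounded_differences) simp
    ultimately have "tvs_bounded (range x)"
      by (rule tvs_bounded_subset[rotated])
    then have "ell1_sequence x"
      by (rule independent_on_polar_ell1_sequence[OF assms(2) _ V(1,2) ind x(2)])
    then show False
      using assms(3) by metis
  qed
  moreover have "(\<lambda>a. - k a) \<in> polar (V n)" if "k \<in> polar (V n)" for n k
    using that by (simp add: polar_def linear_compose_neg)
  ultimately obtain a where a: "range a \<subseteq> A" "\<forall>n. \<forall>k\<in>polar (V n). (\<lambda>i. k (a i)) \<longlonglongrightarrow> 0"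
    by (rule adherent_zero_sequence)
  have "\<forall>i. \<exists>x. x \<in> C \<and> a i = x - f x"
    using a(1) by (auto simp: A_def)
  then obtain x where x: "\<And>i. x i \<in> C" "\<And>i. a i = x i - f (x i)"
    by metis
  have "(\<lambda>n. \<phi> (x n - f (x n))) \<longlonglongrightarrow> 0" if \<phi>: "\<phi> \<in> topological_dual" for \<phi>
  proof -
    obtain U where U: "open U" "0 \<in> U" "\<And>V. V \<subseteq> U \<Longrightarrow> \<phi> \<in> polar V"
      using topological_dual_mem_polar[OF \<phi>] by metis
    obtain n where "V n \<subseteq> U"
      using V(4)[OF U(1,2)] by metis
    then have "\<phi> \<in> polar (V n)"
      by (rule U(3))
    then have "(\<lambda>i. \<phi> (a i)) \<longlonglongrightarrow> 0"
      by (rule bspec[OF spec[OF a(2)]])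
    then show ?thesis
      by (simp only: x(2))
  qed
  then show "\<exists>x. (\<forall>n. x n \<in> C) \<and> (\<forall>\<phi>\<in>topological_dual. (\<lambda>n. \<phi> (x n - f (x n))) \<longlonglongrightarrow> 0)"
    using x(1) by (intro exI[of _ x]) auto
qed

end
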